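(* Let the quantum game be two-player zero-sum, i.e. $N=2$ and $u_1=-u_2$, and suppose it admits a full-rank Nash equilibrium $X^*=(X_1^*,X_2^* )$ (each $X_i^*$ positive definite). Then for Lebesgue-almost every initial condition $Y(0)\in\mathbb H^{d_1}\times\mathbb H^{d_2}$, the FTQL trajectory $X(t)=Q(Y(t))$ is Poincaré recurrent: there exists an increasing sequence of times $t_n\to\infty$ such that $X(t_n)\to X(0)$ as $n\to\infty$.
   Context: Quantum game: players $i\in\{1,\dots,N\}$, integers $d_i\ge1$; $\mathbb H^{d}$ is the real vector space of $d\times d$ complex Hermitian matrices; $\mathcal X_i=\{X_i\in\mathbb H^{d_i}:X_i\succeq0,\operatorname{tr}X_i=1\}$, $\mathcal X=\prod_i\mathcal X_i$. Payoffs $u_i(X)=\sum_{\omega\in\Omega}U_i(\omega)\operatorname{tr}[P_\omega(X_1\otimes\cdots\otimes X_N)]$ for a finite set $\Omega$, positive semidefinite $P_\omega$ with $\sum_\omega P_\omega=I$, and real $U_i$. The payoff gradient $V_i(X)\in\mathbb H^{d_i}$ is the unique Hermitian matrix with $u_i(A;X_{-i})=\operatorname{tr}(AV_i(X))$ for all $A\in\mathbb H^{d_i}$. $X^*$ is a Nash equilibrium if $u_i(X^* )\ge u_i(X_i;X^*_{-i})$ for all $X_i\in\mathcal X_i$ and all $i$. Regularizers $h_i(X_i)=\operatorname{tr}\theta_i(X_i)$ with $\theta_i:[0,1]\to\mathbb R$ continuous, twice differentiable on $(0,1]$, $\theta_i(0)=0$, $\inf_{(0,1]}\theta_i''>0$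 (matrix functions via eigendecomposition). Mirror map $Q_i(Y_i)=\arg\max_{X_i\in\mathcal X_i}\{\operatorname{tr}(Y_iX_i)-h_i(X_i)\}$, $Q=\prod Q_i$. FTQL dynamics: $\dot Y_i=V_i(X)$, $X_i=Q_i(Y_i)$. *)

theory Defs
  imports "HOL-Analysis.Analysis"
begin

definition cadj :: "complex^'n^'n \<Rightarrow> complex^'n^'n" where
  "cadj A = (\<chi> i j. cnj (A $ j $ i))"

definition hermitian :: "complex^'n^'n \<Rightarrow> bool" where
  "hermitian A \<longleftrightarrow> cadj A = A"

definition cquad :: "complex^'n^'n \<Rightarrow> complex^'n \<Rightarrow> complex" where
  "cquad A x = (\<Sum>i\<in>UNIV. cnj (x $ i) * (A *v x) $ i)"

definition psd :: "complex^'n^'n \<Rightarrow> bool" where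
  "psd A \<longleftrightarrow> hermitian A \<and> (\<forall>x. 0 \<le> Re (cquad A x))"

definition posdef :: "complex^'n^'n \<Rightarrow> bool" where
  "posdef A \<longleftrightarrow> hermitian A \<and> (\<forall>x. x \<noteq> 0 \<longrightarrow> 0 < Re (cquad A x))"

definition unitary :: "complex^'n^'n \<Rightarrow> bool" where
  "unitary U \<longleftrightarrow> U ** cadj U = mat 1 \<and> cadj U ** U = mat 1"

definition diagm :: "('n \<Rightarrow> complex) \<Rightarrow> complex^'n^'n" where
  "diagm d = (\<chi> i j. if i = j then d i else 0)"

definition density :: "(complex^'n^'n) set" where
  "density = {X. psd X \<and> trace X = 1}"

definition kron :: "complex^'n^'n \<Rightarrow> complex^'m^'m \<Rightarrow> complex^('n \<times> 'm)^('n \<times> 'm)" where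
  "kron A B = (\<chi> p q. A $ fst p $ fst q * B $ snd p $ snd q)"

text \<open>Linear isomorphism from real n x n matrices onto Hermitian matrices:
  a |-> sym(a) + i antisym(a).  Used to transport Lebesgue measure.\<close>
definition herm_of :: "real^'n^'n \<Rightarrow> complex^'n^'n" where
  "herm_of a = (\<chi> i j. Complex ((a $ i $ j + a $ j $ i) / 2) ((a $ i $ j - a $ j $ i) / 2))"

definition admissible_kernel :: "(real \<Rightarrow> real) \<Rightarrow> bool" where
  "admissible_kernel \<theta> \<longleftrightarrow>
     continuous_on {0..1} \<theta> \<and> \<theta> 0 = 0 \<and>
     (\<exists>\<theta>' \<theta>''. (\<forall>x\<in>{0<..1}. (\<theta> has_real_derivative \<theta>' x) (at x within {0<..1}) \<and>
                                (\<theta>' has_real_derivative \<theta>'' x) (at x within {0<..1}))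
              \<and> (\<exists>c>0. \<forall>x\<in>{0<..1}. c \<le> \<theta>'' x))"

text \<open>Regularizer h(X) = tr theta(X), matrix function via eigendecomposition.\<close>
definition regularizer :: "(real \<Rightarrow> real) \<Rightarrow> complex^'n^'n \<Rightarrow> real" where
  "regularizer \<theta> X = (SOME s. \<exists>U d. unitary U \<and> (\<forall>k. d k \<in> \<real>) \<and>
        X = U ** diagm d ** cadj U \<and> s = (\<Sum>k\<in>UNIV. \<theta> (Re (d k))))"

definition mirror :: "(real \<Rightarrow> real) \<Rightarrow> complex^'n^'n \<Rightarrow> complex^'n^'n" where
  "mirror \<theta> Y = (THE X. X \<in> density \<and>
      (\<forall>X'\<in>density. Re (trace (Y ** X')) - regularizer \<theta> X'
                    \<le> Re (trace (Y ** X)) - regularizer \<theta> X))"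

definition payoff :: "('w::finite \<Rightarrow> complex^('n \<times> 'm)^('n \<times> 'm)) \<Rightarrow> ('w \<Rightarrow> real)
     \<Rightarrow> complex^'n^'n \<Rightarrow> complex^'m^'m \<Rightarrow> real" where
  "payoff P U X1 X2 = Re (\<Sum>w\<in>UNIV. complex_of_real (U w) * trace (P w ** kron X1 X2))"

definition grad1 :: "('w::finite \<Rightarrow> complex^('n \<times> 'm)^('n \<times> 'm)) \<Rightarrow> ('w \<Rightarrow> real)
     \<Rightarrow> complex^'n^'n \<Rightarrow> complex^'m^'m \<Rightarrow> complex^'n^'n" where
  "grad1 P U X1 X2 = (THE V. hermitian V \<and>
      (\<forall>A. hermitian A \<longrightarrow> payoff P U A X2 = Re (trace (A ** V))))"

definition grad2 :: "('w::finite \<Rightarrow> complex^('n \<times> 'm)^('n \<times> 'm)) \<Rightarrow> ('w \<Rightarrow> real)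
     \<Rightarrow> complex^'n^'n \<Rightarrow> complex^'m^'m \<Rightarrow> complex^'m^'m" where
  "grad2 P U X1 X2 = (THE V. hermitian V \<and>
      (\<forall>A. hermitian A \<longrightarrow> payoff P U X1 A = Re (trace (A ** V))))"

definition povm :: "('w::finite \<Rightarrow> complex^'k^'k) \<Rightarrow> bool" where
  "povm P \<longleftrightarrow> (\<forall>w. psd (P w)) \<and> (\<Sum>w\<in>UNIV. P w) = mat 1"

definition nash_eq :: "('w::finite \<Rightarrow> complex^('n \<times> 'm)^('n \<times> 'm)) \<Rightarrow> ('w \<Rightarrow> real) \<Rightarrow> ('w \<Rightarrow> real)
     \<Rightarrow> complex^'n^'n \<Rightarrow> complex^'m^'m \<Rightarrow> bool" where
  "nash_eq P U1 U2 X1 X2 \<longleftrightarrow> X1 \<in> density \<and> X2 \<in> density \<and>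
     (\<forall>Z\<in>density. payoff P U1 Z X2 \<le> payoff P U1 X1 X2) \<and>
     (\<forall>Z\<in>density. payoff P U2 X1 Z \<le> payoff P U2 X1 X2)"

definition ftql_solution :: "('w::finite \<Rightarrow> complex^('n \<times> 'm)^('n \<times> 'm)) \<Rightarrow> ('w \<Rightarrow> real) \<Rightarrow> ('w \<Rightarrow> real)
     \<Rightarrow> (real \<Rightarrow> real) \<Rightarrow> (real \<Rightarrow> real)
     \<Rightarrow> (real \<Rightarrow> (complex^'n^'n) \<times> (complex^'m^'m)) \<Rightarrow> bool" where
  "ftql_solution P U1 U2 \<theta>1 \<theta>2 Y \<longleftrightarrow>
     (\<forall>t\<ge>0. (Y has_vector_derivative
        (grad1 P U1 (mirror \<theta>1 (fst (Y t))) (mirror \<theta>2 (snd (Y t))),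
         grad2 P U2 (mirror \<theta>1 (fst (Y t))) (mirror \<theta>2 (snd (Y t))))) (at t within {0..}))"

end

theory Submission
  imports Defs
begin

text \<open>
  A Hermitian matrix is encoded by its real coordinates under the isometry \<open>herm_of\<close>.
  In a zero-sum game each player's score \<open>Y\<^sub>i\<close> is driven by the other player only, so the field
  \<open>(V\<^sub>1(Q\<^sub>2(Y\<^sub>2)), V\<^sub>2(Q\<^sub>1(Y\<^sub>1)))\<close> is divergence free. It is merely Lipschitz, and
  volume preservation of its flow is obtained by writing the flow as a limit of symplectic Euler
  iterates, which are compositions of measure preserving shears; the same convergence gives uniqueness
  of solutions. At a full-rank equilibrium both payoffs are constant along unilateral deviations, so the
  sum of the two Fenchel couplings with the equilibrium is conserved. The scores are unbounded along
  the identity matrix, which the mirror maps do not see; projecting the field off that direction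
  leaves the primal orbit unchanged and makes the sublevel sets of the energy bounded, whence Poincare
  recurrence applies. Strong convexity of the regularizer, and hence the Lipschitz mirror map, follows
  from Peierls' inequality: \<open>tr \<psi>(X)\<close> is the maximum of \<open>\<Sum>\<^sub>k \<psi>(\<langle>u\<^sub>k, X u\<^sub>k\<rangle>)\<close> over orthonormal bases.
\<close>

section \<open>Poincare recurrence\<close>

text \<open>The field is only Lipschitz because a kernel may have finite slope at 0: the maximiser
  can then be rank deficient, where the mirror map need not be differentiable, so volume
  preservation cannot be read off a divergence. Full rank of the equilibrium enters twice. A linear
  payoff that is maximal at a relatively interior point is constant, which gives conservation
  instead of an inequality; and a ball around the equilibrium within the trace-one hyperplane makes
  the Fenchel coupling grow linearly in every direction that the mirror map sees. Only one
  time-\<tau> map is studied, since its iterates already supply return times tending to infinity. It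
  is fixed before any solution is named, so by uniqueness one null set of initial scores serves all
  solutions.\<close>

lemma funpow_measure_preserving:
  assumes [measurable]: "\<phi> \<in> measurable M M" and "distr M M \<phi> = M"
  shows "(\<phi> ^^ n) \<in> measurable M M" "distr M M (\<phi> ^^ n) = M"
proof -
  have "(\<phi> ^^ n) \<in> measurable M M \<and> distr M M (\<phi> ^^ n) = M"
  proof (induction n)
    case 0
    have "distr M M (\<lambda>x. x) = M" by (rule distr_id2) simp
    then show ?case by (simp add: id_def)
  next
    case (Suc n)
    then have [measurable]: "(\<phi> ^^ n) \<in> measurable M M" by simp
    have "distr M M (\<phi> ^^ Suc n) = distr (distr M M (\<phi> ^^ n)) M \<phi>"
      by (subst distr_distr) (simp_all add: o_def)
    then show ?case using Suc assms by (auto simp: o_def)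
  qed
  then show "(\<phi> ^^ n) \<in> measurable M M" "distr M M (\<phi> ^^ n) = M" by auto
qed

text \<open>The points of \<open>S \<inter> B\<close> that avoid \<open>B\<close> from step
  \<open>m\<close> on form a wandering set for the \<open>m\<close>-th iterate: its preimages under
  multiples of \<open>m\<close> are disjoint, equally large and inside \<open>S\<close>, so finite
  measure forces it to be null. The invariant set \<open>S\<close> stands in for a finite total
  measure.\<close>

lemma recurrence_to_set:
  assumes [measurable]: "\<phi> \<in> measurable M M" and pres: "distr M M \<phi> = M"
    and [measurable]: "S \<in> sets M" "B \<in> sets M"
    and inv: "\<And>x. x \<in> space M \<Longrightarrow> \<phi> x \<in> S \<longleftrightarrow> x \<in> S"
    and fin: "emeasure M S < \<infinity>" and m: "0 < m"
  shows "AE x in M. x \<in> S \<longrightarrow> x \<in> B \<longrightarrow> (\<exists>n\<ge>m. (\<phi> ^^ n) x \<in> B)"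
proof -
  note [measurable] = funpow_measure_preserving(1)[OF assms(1) pres]
  define N where "N = {x \<in> space M. x \<in> S \<and> x \<in> B \<and> (\<forall>n\<ge>m. (\<phi> ^^ n) x \<notin> B)}"
  define A where "A j = (\<phi> ^^ (j * m)) -` N \<inter> space M" for j
  have N[measurable]: "N \<in> sets M" unfolding N_def by measurable
  have A[measurable]: "A j \<in> sets M" for j unfolding A_def by measurable
  have invn: "x \<in> space M \<Longrightarrow> (\<phi> ^^ n) x \<in> S \<longleftrightarrow> x \<in> S" for x n
  proof (induction n)
    case (Suc n)
    have "(\<phi> ^^ n) x \<in> space M" using measurable_space[OF funpow_measure_preserving(1)[OF assms(1) pres]] Suc by blast
    then show ?case using Suc inv by simp
  qed simp
  have AS: "A j \<subseteq> S" for j unfolding A_def N_def using invn by auto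
  have eA: "emeasure M (A j) = emeasure M N" for j
    using emeasure_distr[of "\<phi> ^^ (j*m)" M M N] funpow_measure_preserving(2)[OF assms(1) pres, of "j*m"]
    by (simp add: A_def)
  have finA: "A j \<in> fmeasurable M" for j
    using AS emeasure_mono[OF AS[of j] assms(3)] fin by (intro fmeasurableI) (auto simp: top.not_eq_extremum intro: le_less_trans)
  have SF: "S \<in> fmeasurable M" using fin by (intro fmeasurableI) auto
  have disj: "disjoint_family A"
  proof -
    have *: "A j \<inter> A k = {}" if "j < k" for j k
    proof (rule ccontr)
      assume "A j \<inter> A k \<noteq> {}"
      then obtain x where x: "x \<in> A j" "x \<in> A k" by blast
      have "(\<phi> ^^ ((k-j)*m)) ((\<phi> ^^ (j*m)) x) = (\<phi> ^^ (k*m)) x"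
        using that by (metis add.commute comp_apply diff_mult_distrib funpow_add le_add_diff_inverse less_imp_le mult_le_mono1)
      moreover have "(k-j)*m \<ge> m" using that mult_le_mono1[of 1 "k-j" m] by (simp add: Suc_le_eq)
      moreover have "(\<phi> ^^ (k*m)) x \<in> B" "\<forall>n\<ge>m. (\<phi> ^^ n) ((\<phi> ^^ (j*m)) x) \<notin> B"
        using x unfolding A_def N_def by blast+
      ultimately show False by metis
    qed
    show ?thesis unfolding disjoint_family_on_def
      using * by (metis Int_commute nat_neq_iff)
  qed
  have le: "real k * measure M N \<le> measure M S" for k
  proof -
    have "measure M (\<Union>j<k. A j) = (\<Sum>j<k. measure M (A j))"
      using finA disj by (intro measure_UNION_AE[symmetric] measure_finite_Union)
        (auto simp: fmeasurable_def disjoint_family_on_def top.not_eq_extremum)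
    also have "\<dots> = real k * measure M N" by (simp add: measure_def eA)
    finally have "real k * measure M N = measure M (\<Union>j<k. A j)" ..
    also have "\<dots> \<le> measure M S" using AS by (intro measure_mono_fmeasurable SF) auto
    finally show ?thesis .
  qed
  have "measure M N = 0"
  proof (rule ccontr)
    assume "measure M N \<noteq> 0"
    then have "measure M N > 0" by (simp add: zero_less_measure_iff)
    then obtain k where "real k * measure M N > measure M S" using reals_Archimedean3 by blast
    then show False using le[of k] by simp
  qed
  moreover have "N \<in> fmeasurable M" using finA[of 0] by (simp add: A_def N_def Int_def conj_ac cong: conj_cong)
  ultimately have "emeasure M N = 0" by (simp add: emeasure_eq_measure2)
  then have "AE x in M. x \<notin> N" by (intro AE_not_in null_setsI) auto
  then show ?thesis by (rule AE_mp) (auto simp: N_def)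
qed

text \<open>Countably many basis sets and lower bounds on the return time cost one null set in all.
  Returns to ever smaller neighbourhoods, each later than the last, are then picked by dependent
  choice.\<close>

theorem poincare_recurrence:
  fixes M :: "'a::{second_countable_topology, metric_space} measure"
  assumes M: "sets M = sets borel" and \<phi>: "\<phi> \<in> measurable M M" and pres: "distr M M \<phi> = M"
    and S: "S \<in> sets M" and inv: "\<And>x. \<phi> x \<in> S \<longleftrightarrow> x \<in> S" and fin: "emeasure M S < \<infinity>"
  shows "AE x in M. x \<in> S \<longrightarrow> (\<exists>r::nat\<Rightarrow>nat. strict_mono r \<and> (\<lambda>n. (\<phi> ^^ r n) x) \<longlonglongrightarrow> x)"
proof -
  obtain D :: "'a set set" where D: "countable D" "topological_basis D"
    using ex_countable_basis by blast
  have "AE x in M. \<forall>B\<in>D. \<forall>m\<in>{0<..}. x \<in> S \<longrightarrow> x \<in> B \<longrightarrow> (\<exists>n\<ge>m. (\<phi> ^^ n) x \<in> B)"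
    using D(1)
  proof (intro AE_ball_countable' recurrence_to_set[OF \<phi> pres S _ inv fin])
    fix B assume "B \<in> D"
    then show "B \<in> sets M" using D(2) by (simp add: M topological_basis_open)
  qed auto
  then show ?thesis
  proof (rule AE_mp, intro AE_I2 impI)
    fix x assume *: "\<forall>B\<in>D. \<forall>m\<in>{0<..}. x \<in> S \<longrightarrow> x \<in> B \<longrightarrow> (\<exists>n\<ge>m. (\<phi> ^^ n) x \<in> B)" and "x \<in> S"
    have ret: "\<exists>n>m. dist ((\<phi> ^^ n) x) x < e" if "e > 0" for e m
    proof -
      have "x \<in> ball x e" using that by simp
      then obtain B where B: "B \<in> D" "x \<in> B" "B \<subseteq> ball x e"
        by (rule topological_basisE[OF D(2) open_ball])
      then obtain n where "n \<ge> Suc m" "(\<phi> ^^ n) x \<in> B" using * \<open>x \<in> S\<close> by (meson greaterThan_iff zero_less_Suc)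
      then show ?thesis using B by (intro exI[of _ n]) (auto simp: dist_commute)
    qed
    obtain r :: "nat \<Rightarrow> nat" where r: "\<And>n. dist ((\<phi> ^^ r n) x) x < 1 / Suc n" "\<And>n. r n < r (Suc n)"
      using dependent_nat_choice[of "\<lambda>n k. dist ((\<phi> ^^ k) x) x < 1 / Suc n" "\<lambda>n k k'. k < k'"]
        ret[of "1 / real (Suc _)"] by (metis of_nat_0_less_iff zero_less_Suc zero_less_divide_1_iff)
    have "(\<lambda>n. dist ((\<phi> ^^ r n) x) x) \<longlonglongrightarrow> 0"
      by (rule tendsto_sandwich[OF _ _ tendsto_const LIMSEQ_inverse_real_of_nat])
        (auto intro!: always_eventually less_imp_le[OF r(1)[unfolded inverse_eq_divide[symmetric]]] simp del: of_nat_Suc)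
    then show "\<exists>r::nat\<Rightarrow>nat. strict_mono r \<and> (\<lambda>n. (\<phi> ^^ r n) x) \<longlonglongrightarrow> x"
      using r(2) by (intro exI[of _ r]) (auto simp: strict_mono_Suc_iff tendsto_dist_iff[of _ x])
  qed
qed

section \<open>Measure preserving maps and ordinary differential equations\<close>

lemma sets_lborel_pair:
  "sets (lborel \<Otimes>\<^sub>M lborel :: ('a::euclidean_space \<times> 'b::euclidean_space) measure) = sets borel"
  by (simp only: lborel_prod sets_lborel)

text \<open>By Fubini it is enough to compare slices: at height \<open>y\<close> the map is the
  translation by \<open>g y\<close>, which preserves Lebesgue measure.\<close>

lemma distr_lborel_shear_fst:
  fixes g :: "'b::euclidean_space \<Rightarrow> 'a::euclidean_space"
  assumes [measurable]: "g \<in> borel_measurable borel"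
  shows "distr lborel lborel (\<lambda>p. (fst p + g (snd p), snd p)) = (lborel :: ('a \<times> 'b) measure)"
proof (rule measure_eqI)
  fix A :: "('a \<times> 'b) set" assume "A \<in> sets (distr lborel lborel (\<lambda>p. (fst p + g (snd p), snd p)))"
  then have A[measurable]: "A \<in> sets borel" by simp
  define T where "T = (\<lambda>p::'a \<times> 'b. (fst p + g (snd p), snd p))"
  have T[measurable]: "T \<in> borel_measurable borel" unfolding T_def borel_prod[symmetric] by measurable
  have A2: "A \<in> sets (lborel \<Otimes>\<^sub>M lborel)" "T -` A \<in> sets (lborel \<Otimes>\<^sub>M lborel)"
    using A measurable_sets[OF T A] by (simp_all only: sets_lborel_pair space_borel Int_UNIV_right)
  have slice: "emeasure lborel ((\<lambda>x. (x, y)) -` (T -` A)) = emeasure lborel ((\<lambda>x. (x, y)) -` A)" for y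
  proof -
    have [measurable]: "(\<lambda>x. (x, y)) -` A \<in> sets borel"
      using sets_Pair2[OF A2(1), of y] by simp
    have "emeasure lborel ((\<lambda>x. (x, y)) -` A) = emeasure (distr lborel borel ((+) (g y))) ((\<lambda>x. (x, y)) -` A)"
      by (simp add: lborel_distr_plus)
    also have "\<dots> = emeasure lborel ((+) (g y) -` ((\<lambda>x. (x, y)) -` A))"
      by (subst emeasure_distr) auto
    also have "(+) (g y) -` ((\<lambda>x. (x, y)) -` A) = (\<lambda>x. (x, y)) -` (T -` A)"
      by (auto simp: T_def add.commute)
    finally show ?thesis by simp
  qed
  have "emeasure (distr lborel lborel T) A = emeasure lborel (T -` A)"
    by (subst emeasure_distr) auto
  also have "\<dots> = emeasure (lborel \<Otimes>\<^sub>M lborel) (T -` A)" by (simp add: lborel_prod)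
  also have "\<dots> = emeasure (lborel \<Otimes>\<^sub>M lborel) A"
    using A2 by (simp add: lborel_pair.emeasure_pair_measure_alt2 slice)
  finally show "emeasure (distr lborel lborel (\<lambda>p. (fst p + g (snd p), snd p))) A = emeasure lborel A"
    by (simp add: lborel_prod T_def)
qed simp

lemma distr_lborel_shear_snd:
  fixes g :: "'a::euclidean_space \<Rightarrow> 'b::euclidean_space"
  assumes [measurable]: "g \<in> borel_measurable borel"
  shows "distr lborel lborel (\<lambda>p. (fst p, snd p + g (fst p))) = (lborel :: ('a \<times> 'b) measure)"
proof (rule measure_eqI)
  fix A :: "('a \<times> 'b) set" assume "A \<in> sets (distr lborel lborel (\<lambda>p. (fst p, snd p + g (fst p))))"
  then have A[measurable]: "A \<in> sets borel" by simp
  define T where "T = (\<lambda>p::'a \<times> 'b. (fst p, snd p + g (fst p)))"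
  have T[measurable]: "T \<in> borel_measurable borel" unfolding T_def borel_prod[symmetric] by measurable
  have A2: "A \<in> sets (lborel \<Otimes>\<^sub>M lborel)" "T -` A \<in> sets (lborel \<Otimes>\<^sub>M lborel)"
    using A measurable_sets[OF T A] by (simp_all only: sets_lborel_pair space_borel Int_UNIV_right)
  have slice: "emeasure lborel (Pair x -` (T -` A)) = emeasure lborel (Pair x -` A)" for x
  proof -
    have [measurable]: "Pair x -` A \<in> sets borel"
      using sets_Pair1[OF A2(1), of x] by simp
    have "emeasure lborel (Pair x -` A) = emeasure (distr lborel borel ((+) (g x))) (Pair x -` A)"
      by (simp add: lborel_distr_plus)
    also have "\<dots> = emeasure lborel ((+) (g x) -` (Pair x -` A))"
      by (subst emeasure_distr) auto
    also have "(+) (g x) -` (Pair x -` A) = Pair x -` (T -` A)"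
      by (auto simp: T_def add.commute)
    finally show ?thesis by simp
  qed
  have "emeasure (distr lborel lborel T) A = emeasure lborel (T -` A)"
    by (subst emeasure_distr) auto
  also have "\<dots> = emeasure (lborel \<Otimes>\<^sub>M lborel) (T -` A)" by (simp add: lborel_prod)
  also have "\<dots> = emeasure (lborel \<Otimes>\<^sub>M lborel) A"
    using A2 by (simp add: lborel.emeasure_pair_measure_alt slice)
  finally show "emeasure (distr lborel lborel (\<lambda>p. (fst p, snd p + g (fst p)))) A = emeasure lborel A"
    by (simp add: lborel_prod T_def)
qed simp

text \<open>Agreement on boxes identifies Lebesgue measure. The indicator of a box does not pass
  through a pointwise limit, so it is first replaced by continuous functions below it. The
  displacement bound \<open>D\<close> is the source of the dominating function: everything sent into
  the box starts in one fixed ball.\<close>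

lemma limit_lborel_preserving:
  fixes \<phi> :: "'a::euclidean_space \<Rightarrow> 'a" and f :: "nat \<Rightarrow> 'a \<Rightarrow> 'a"
  assumes [measurable]: "\<And>n. f n \<in> borel_measurable borel"
    and pres: "\<And>n. distr lborel lborel (f n) = lborel"
    and lim: "\<And>p. (\<lambda>n. f n p) \<longlonglongrightarrow> \<phi> p"
    and bd: "\<And>n p. norm (f n p - p) \<le> D"
  shows "\<phi> \<in> borel_measurable borel" "distr lborel lborel \<phi> = lborel"
proof -
  show [measurable]: "\<phi> \<in> borel_measurable borel"
    by (rule borel_measurable_LIMSEQ_metric[OF _ lim]) simp
  have "lborel = distr lborel lborel \<phi>"
  proof (rule lborel_eqI)
    fix l u :: 'a assume lu: "\<And>b. b \<in> Basis \<Longrightarrow> l \<bullet> b \<le> u \<bullet> b"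
    define U where "U = box l u"
    have [measurable]: "U \<in> sets borel" by (simp add: U_def)
    obtain R where R: "\<And>x. x \<in> U \<Longrightarrow> norm x \<le> R"
      using bounded_box[of l u] unfolding bounded_iff U_def by blast
    define h where "h k x = ennreal (min 1 (real k * infdist x (- U)))" for k x
    have [measurable]: "h k \<in> borel_measurable borel" for k
      unfolding h_def by (intro measurable_compose[OF _ measurable_ennreal] borel_measurable_continuous_onI continuous_intros)
    have h_le: "h k x \<le> indicator U x" for k x
      by (auto simp: h_def indicator_def)
    \<comment> \<open>\<open>infdist\<close> to the empty set is 0 by convention, so positivity
      inside the box requires a nonempty complement.\<close>
    have UU: "- U \<noteq> {}"
      using bounded_box[of l u] not_bounded_UNIV[where 'a='a] unfolding U_def by (metis double_compl Compl_empty_eq)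
    have h_lim: "(\<lambda>k. h k x) \<longlonglongrightarrow> indicator U x" for x
    proof (cases "x \<in> U")
      case True
      then have "infdist x (- U) > 0"
        using UU by (intro infdist_pos_not_in_closed) (auto simp: U_def closed_Compl)
      then obtain k0 where k0: "1 < real k0 * infdist x (- U)" using reals_Archimedean3 by blast
      have "h k x = 1" if "k \<ge> k0" for k
      proof -
        have "1 < real k * infdist x (- U)"
          using that by (intro less_le_trans[OF k0] mult_right_mono) (auto simp: infdist_nonneg)
        then show ?thesis by (simp add: h_def)
      qed
      then show ?thesis using True by (intro tendsto_eventually eventually_sequentiallyI[of k0]) auto
    qed (auto simp: h_def)
    have fin: "emeasure lborel U < \<infinity>" unfolding U_def by (simp add: emeasure_lborel_box_eq less_top)
    have key: "(\<integral>\<^sup>+x. h k (\<phi> x) \<partial>lborel) = (\<integral>\<^sup>+x. h k x \<partial>lborel)" for k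
    proof -
      have conth: "isCont (\<lambda>x. min 1 (real k * infdist x (- U))) x" for x
        by (intro continuous_intros)
      have "(\<lambda>n. \<integral>\<^sup>+x. h k (f n x) \<partial>lborel) \<longlonglongrightarrow> (\<integral>\<^sup>+x. h k (\<phi> x) \<partial>lborel)"
      proof (rule nn_integral_dominated_convergence[where w="indicator (cball 0 (R + D))"])
        show "AE x in lborel. h k (f j x) \<le> indicator (cball 0 (R + D)) x" for j
        proof (rule AE_I2)
          fix x
          have "norm x \<le> R + D" if "f j x \<in> U"
            using R[OF that] bd[of j x] norm_triangle_ineq4[of "f j x" "f j x - x"] by simp
          then show "h k (f j x) \<le> indicator (cball 0 (R + D)) x"
            using order_trans[OF h_le[of k "f j x"]] by (cases "f j x \<in> U") simp_all
        qed
        show "AE x in lborel. (\<lambda>i. h k (f i x)) \<longlonglongrightarrow> h k (\<phi> x)"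
          unfolding h_def by (intro AE_I2 tendsto_ennrealI isCont_tendsto_compose[OF conth] lim)
        show "(\<integral>\<^sup>+x. indicator (cball 0 (R + D)) x \<partial>(lborel::'a measure)) < \<infinity>"
          using emeasure_bounded_finite[of "cball (0::'a) (R + D)"] by simp
      qed (auto intro!: borel_measurable_indicator)
      moreover have "(\<integral>\<^sup>+x. h k (f n x) \<partial>lborel) = (\<integral>\<^sup>+x. h k x \<partial>lborel)" for n
        using nn_integral_distr[of "f n" lborel lborel "h k"] pres[of n] by simp
      ultimately show ?thesis by (simp add: LIMSEQ_const_iff)
    qed
    have "(\<lambda>k. \<integral>\<^sup>+x. h k x \<partial>lborel) \<longlonglongrightarrow> (\<integral>\<^sup>+x. indicator U x \<partial>lborel)"
      using fin h_le h_lim by (intro nn_integral_dominated_convergence[where w="indicator U"]) auto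
    moreover have "(\<lambda>k. \<integral>\<^sup>+x. h k (\<phi> x) \<partial>lborel) \<longlonglongrightarrow> (\<integral>\<^sup>+x. indicator U (\<phi> x) \<partial>lborel)"
    proof (intro nn_integral_dominated_convergence[where w="indicator (cball 0 (R + D))"])
      show "AE x in lborel. h k (\<phi> x) \<le> indicator (cball 0 (R + D)) x" for k
      proof (rule AE_I2)
        fix x
        have "norm (\<phi> x - x) \<le> D"
          by (rule LIMSEQ_le_const2[OF tendsto_norm[OF tendsto_diff[OF lim tendsto_const]]]) (use bd in auto)
        then have "norm x \<le> R + D" if "\<phi> x \<in> U"
          using R[OF that] norm_triangle_ineq4[of "\<phi> x" "\<phi> x - x"] by simp
        then show "h k (\<phi> x) \<le> indicator (cball 0 (R + D)) x"
          using order_trans[OF h_le[of k "\<phi> x"]] by (cases "\<phi> x \<in> U") simp_all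
      qed
      show "(\<integral>\<^sup>+x. indicator (cball 0 (R + D)) x \<partial>(lborel::'a measure)) < \<infinity>"
        using emeasure_bounded_finite[of "cball (0::'a) (R + D)"] by simp
    qed (use h_lim in \<open>auto intro!: borel_measurable_indicator\<close>)
    ultimately have eq: "(\<integral>\<^sup>+x. indicator U (\<phi> x) \<partial>lborel) = (\<integral>\<^sup>+x. indicator U x \<partial>lborel)"
      unfolding key by (rule LIMSEQ_unique[symmetric])
    have "(\<integral>\<^sup>+x. indicator U x \<partial>distr lborel lborel \<phi>) = (\<integral>\<^sup>+x. indicator U (\<phi> x) \<partial>lborel)"
      by (rule nn_integral_distr) auto
    with eq have "emeasure (distr lborel lborel \<phi>) U = emeasure lborel U"
      by (metis \<open>U \<in> sets borel\<close> nn_integral_indicator sets_distr sets_lborel)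
    then show "emeasure (distr lborel lborel \<phi>) (box l u) = (\<Prod>b\<in>Basis. (u - l) \<bullet> b)"
      using lu by (simp add: U_def)
  qed simp
  then show "distr lborel lborel \<phi> = lborel" ..
qed

text \<open>Picard iteration: for \<open>\<tau> * L < 1\<close> the integral operator contracts the
  plain supremum distance.\<close>

lemma lipschitz_ode_exists:
  fixes G :: "'a::banach \<Rightarrow> 'a"
  assumes lip: "L-lipschitz_on UNIV G" and \<tau>: "0 < \<tau>" "\<tau> * L < 1"
  shows "\<exists>z. z 0 = p \<and> (\<forall>t\<in>{0..\<tau>}. (z has_vector_derivative G (z t)) (at t within {0..\<tau>}))"
proof -
  have L: "L \<ge> 0" using lip by (rule lipschitz_on_nonneg)
  have contG: "continuous_on UNIV G" using lip by (rule lipschitz_on_continuous_on)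
  have contGu: "continuous_on S (\<lambda>s. G (apply_bcontfun u s))" for u :: "real \<Rightarrow>\<^sub>C 'a" and S
    by (rule continuous_on_compose2[OF contG]) auto
  \<comment> \<open>Clamping time to the interval lets the operator act on bounded continuous
    functions on the whole line; outside the interval its values are frozen.\<close>
  define cl where "cl t = max 0 (min \<tau> t)" for t :: real
  have cl: "cl t \<in> {0..\<tau>}" for t using \<tau> by (auto simp: cl_def)
  define \<Phi>0 where "\<Phi>0 u t = p + integral {0..cl t} (\<lambda>s. G (apply_bcontfun u s))" for u t
  have \<Phi>0: "\<Phi>0 u \<in> bcontfun" for u
  proof -
    define J where "J x = integral {0..x} (\<lambda>s. G (apply_bcontfun u s))" for x
    have J: "continuous_on {0..\<tau>} J"
      unfolding J_def by (intro indefinite_integral_continuous_1 integrable_continuous_real contGu)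
    obtain b where b: "\<And>x. x \<in> {0..\<tau>} \<Longrightarrow> norm (J x) \<le> b"
      using compact_imp_bounded[OF compact_continuous_image[OF J compact_Icc]] unfolding bounded_iff by blast
    have "continuous_on UNIV cl" unfolding cl_def by (intro continuous_intros)
    then have "continuous_on UNIV (\<lambda>t. J (cl t))"
      using cl by (intro continuous_on_compose2[OF J]) auto
    then show ?thesis
      unfolding \<Phi>0_def J_def[symmetric]
      by (intro bcontfun_normI[where b="norm p + b"] continuous_intros norm_triangle_mono order_refl b cl)
  qed
  define \<Phi> where "\<Phi> u = Bcontfun (\<Phi>0 u)" for u
  have \<Phi>: "apply_bcontfun (\<Phi> u) = \<Phi>0 u" for u
    unfolding \<Phi>_def using \<Phi>0 by (rule Bcontfun_inverse)
  have "\<exists>!u. \<Phi> u = u"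
  proof (rule banach_fix_type[of "\<tau> * L"], goal_cases)
    case 3
    show ?case
    proof (intro allI dist_bound)
      fix u v t
      have "dist (\<Phi> u t) (\<Phi> v t) = norm (integral {0..cl t} (\<lambda>s. G (u s) - G (v s)))"
        unfolding \<Phi> \<Phi>0_def dist_norm by (subst integral_diff) (auto intro: integrable_continuous_real contGu)
      also have "\<dots> \<le> (L * dist u v) * (cl t - 0)"
      proof (rule integral_bound)
        fix s
        have "norm (G (u s) - G (v s)) \<le> L * dist (u s) (v s)"
          using lipschitz_onD[OF lip, of "u s" "v s"] by (simp add: dist_norm)
        also have "\<dots> \<le> L * dist u v" by (intro mult_left_mono dist_bounded L)
        finally show "norm (G (u s) - G (v s)) \<le> L * dist u v" .
      qed (use cl in \<open>auto intro!: continuous_intros contGu\<close>)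
      also have "\<dots> \<le> (L * dist u v) * \<tau>" using cl[of t] L by (intro mult_left_mono) auto
      finally show "dist (\<Phi> u t) (\<Phi> v t) \<le> \<tau> * L * dist u v" by (simp add: ac_simps)
    qed
  qed (use \<tau> L in auto)
  then obtain u where u: "\<Phi> u = u" by blast
  have ut: "u t = p + integral {0..t} (\<lambda>s. G (u s))" if "t \<in> {0..\<tau>}" for t
  proof -
    have "cl t = t" using that by (auto simp: cl_def)
    have "u t = \<Phi>0 u t" using \<Phi>[of u] unfolding u by (rule fun_cong)
    also have "\<dots> = p + integral {0..t} (\<lambda>s. G (u s))" unfolding \<Phi>0_def \<open>cl t = t\<close> ..
    finally show ?thesis .
  qed
  have "(u has_vector_derivative G (u t)) (at t within {0..\<tau>})" if t: "t \<in> {0..\<tau>}" for t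
  proof -
    have "((\<lambda>t. p + integral {0..t} (\<lambda>s. G (u s))) has_vector_derivative 0 + G (u t)) (at t within {0..\<tau>})"
      by (intro derivative_intros integral_has_vector_derivative contGu t)
    then show ?thesis
      using has_vector_derivative_transform[OF t ut] by simp
  qed
  moreover have "u 0 = p" using ut[of 0] \<tau> by simp
  ultimately show ?thesis by blast
qed

text \<open>The mean value inequality for \<open>f t - t *\<^sub>R v\<close>. Taking
  \<open>v = 0\<close> bounds a displacement; taking a frozen value of the field for
  \<open>v\<close> bounds the error of one Euler step.\<close>

lemma has_vector_derivative_bound:
  fixes f :: "real \<Rightarrow> 'a::real_normed_vector"
  assumes "a \<le> b" and der: "\<And>t. t \<in> {a..b} \<Longrightarrow> (f has_vector_derivative f' t) (at t within {a..b})"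
    and bd: "\<And>t. t \<in> {a..b} \<Longrightarrow> norm (f' t - v) \<le> B"
  shows "norm (f b - f a - (b - a) *\<^sub>R v) \<le> B * (b - a)"
proof -
  have B: "0 \<le> B" using bd[of a] assms(1) norm_ge_zero[of "f' a - v"] by (auto intro: order_trans simp del: norm_ge_zero)
  have "norm ((f b - b *\<^sub>R v) - (f a - a *\<^sub>R v)) \<le> B * norm (b - a)"
  proof (rule differentiable_bound[of "{a..b}" "\<lambda>t. f t - t *\<^sub>R v" "\<lambda>t h. h *\<^sub>R (f' t - v)"])
    fix t assume t: "t \<in> {a..b}"
    have "((\<lambda>t. t *\<^sub>R v) has_vector_derivative v) (at t within {a..b})"
      by (auto simp: has_vector_derivative_def intro!: derivative_eq_intros)
    with der[OF t] have "((\<lambda>t. f t - t *\<^sub>R v) has_vector_derivative f' t - v) (at t within {a..b})"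
      by (rule has_vector_derivative_diff)
    then show "((\<lambda>t. f t - t *\<^sub>R v) has_derivative (\<lambda>h. h *\<^sub>R (f' t - v))) (at t within {a..b})"
      by (simp add: has_vector_derivative_def)
    show "onorm (\<lambda>h. h *\<^sub>R (f' t - v)) \<le> B"
      by (rule onorm_le) (use mult_right_mono[OF bd[OF t] abs_ge_zero] in \<open>simp add: mult.commute\<close>)
  qed (use assms(1) in auto)
  then show ?thesis using assms(1) by (simp add: algebra_simps)
qed

section \<open>Flows of skew Lipschitz fields\<close>

text \<open>Neither component of the field depends on its own variable, so a step in one variable
  alone is a shear. The global bound \<open>C\<close> makes displacements over a fixed time
  uniformly bounded, as \<open>limit_lborel_preserving\<close> requires.\<close>

locale skew_field =
  fixes G1 :: "'b::euclidean_space \<Rightarrow> 'a::euclidean_space" and G2 :: "'a \<Rightarrow> 'b" and L C :: real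
  assumes lip1: "L-lipschitz_on UNIV G1" and lip2: "L-lipschitz_on UNIV G2"
    and bd1: "\<And>y. norm (G1 y) \<le> C" and bd2: "\<And>x. norm (G2 x) \<le> C"
begin

definition "vfield p = (G1 (snd p), G2 (fst p))"

definition solution_on :: "real \<Rightarrow> (real \<Rightarrow> 'a \<times> 'b) \<Rightarrow> bool" where
  "solution_on \<tau> z \<longleftrightarrow> (\<forall>t\<in>{0..\<tau>}. (z has_vector_derivative vfield (z t)) (at t within {0..\<tau>}))"

text \<open>Symplectic Euler: being a composition of two shears, it preserves Lebesgue measure exactly.\<close>
definition euler_step :: "real \<Rightarrow> 'a \<times> 'b \<Rightarrow> 'a \<times> 'b" where
  "euler_step h p = (let x = fst p + h *\<^sub>R G1 (snd p) in (x, snd p + h *\<^sub>R G2 x))"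

definition "norm1 p = norm (fst p) + norm (snd p)" for p :: "'a \<times> 'b"

lemma norm_le_norm1: "norm p \<le> norm1 p"
  unfolding norm1_def using norm_Pair_le[of "fst p" "snd p"] by simp

lemma norm1_triangle: "norm1 (p + q) \<le> norm1 p + norm1 q"
  unfolding norm1_def using norm_triangle_ineq[of "fst p" "fst q"] norm_triangle_ineq[of "snd p" "snd q"] by simp

lemma L_nonneg: "0 \<le> L" using lip1 by (rule lipschitz_on_nonneg)

lemma C_nonneg: "0 \<le> C" using bd1 norm_ge_zero order_trans by blast

lemma lip1': "norm (G1 y - G1 y') \<le> L * norm (y - y')"
  using lipschitz_onD[OF lip1, of y y'] by (simp add: dist_norm)

lemma lip2': "norm (G2 y - G2 y') \<le> L * norm (y - y')"
  using lipschitz_onD[OF lip2, of y y'] by (simp add: dist_norm)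

lemma borel_measurable_G [measurable]:
  "G1 \<in> borel_measurable borel" "G2 \<in> borel_measurable borel"
  using lipschitz_on_continuous_on[OF lip1] lipschitz_on_continuous_on[OF lip2]
  by (auto intro: borel_measurable_continuous_onI)

lemma euler_step_eq:
  "euler_step h = (\<lambda>p. (fst p, snd p + h *\<^sub>R G2 (fst p))) \<circ> (\<lambda>p. (fst p + h *\<^sub>R G1 (snd p), snd p))"
  by (auto simp: euler_step_def Let_def)

lemma euler_step_measurable: "euler_step h \<in> measurable lborel lborel"
proof -
  have "euler_step h \<in> borel_measurable (borel \<Otimes>\<^sub>M borel)"
    unfolding euler_step_def Let_def by measurable
  then show ?thesis by (simp add: borel_prod)
qed

lemma distr_euler_step: "distr lborel lborel (euler_step h) = lborel"
proof -
  have m1: "(\<lambda>p::'a\<times>'b. (fst p + h *\<^sub>R G1 (snd p), snd p)) \<in> borel_measurable (borel \<Otimes>\<^sub>M borel)"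
    and m2: "(\<lambda>p::'a\<times>'b. (fst p, snd p + h *\<^sub>R G2 (fst p))) \<in> borel_measurable (borel \<Otimes>\<^sub>M borel)"
    by measurable
  then show ?thesis
    unfolding euler_step_eq
    by (subst distr_distr[of _ lborel lborel _ lborel, symmetric])
      (simp_all add: borel_prod distr_lborel_shear_fst[of "\<lambda>y. h *\<^sub>R G1 y"] distr_lborel_shear_snd[of "\<lambda>x. h *\<^sub>R G2 x"])
qed

lemma euler_iter:
  "(euler_step h ^^ n) \<in> measurable lborel lborel" "distr lborel lborel (euler_step h ^^ n) = lborel"
  using funpow_measure_preserving[OF euler_step_measurable distr_euler_step] .

section \<open>Convergence of the symplectic Euler scheme\<close>

lemma norm1_euler_step_diff:
  assumes "0 \<le> h"
  shows "norm1 (euler_step h p - euler_step h q) \<le> (1 + h * L)\<^sup>2 * norm1 (p - q)"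
proof -
  obtain x y where p: "p = (x, y)" by (cases p)
  obtain u v where q: "q = (u, v)" by (cases q)
  define a where "a = h * L"
  have a: "a \<ge> 0" using assms L_nonneg by (simp add: a_def)
  define x' u' where "x' = x + h *\<^sub>R G1 y" and "u' = u + h *\<^sub>R G1 v"
  have "x' - u' = (x - u) + h *\<^sub>R (G1 y - G1 v)" by (simp add: x'_def u'_def algebra_simps)
  then have "norm (x' - u') \<le> norm (x - u) + h * norm (G1 y - G1 v)"
    using norm_triangle_ineq[of "x - u" "h *\<^sub>R (G1 y - G1 v)"] assms by simp
  also have "\<dots> \<le> norm (x - u) + h * (L * norm (y - v))"
    using assms lip1' by (intro add_left_mono mult_left_mono)
  finally have 1: "norm (x' - u') \<le> norm (x - u) + a * norm (y - v)" by (simp add: a_def ac_simps)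
  have eq: "(y + h *\<^sub>R G2 x') - (v + h *\<^sub>R G2 u') = (y - v) + h *\<^sub>R (G2 x' - G2 u')" by (simp add: algebra_simps)
  have "norm ((y + h *\<^sub>R G2 x') - (v + h *\<^sub>R G2 u')) \<le> norm (y - v) + h * norm (G2 x' - G2 u')"
    unfolding eq using norm_triangle_ineq[of "y - v" "h *\<^sub>R (G2 x' - G2 u')"] assms by simp
  also have "\<dots> \<le> norm (y - v) + h * (L * norm (x' - u'))"
    using assms lip2' by (intro add_left_mono mult_left_mono)
  finally have 2: "norm ((y + h *\<^sub>R G2 x') - (v + h *\<^sub>R G2 u')) \<le> norm (y - v) + a * norm (x' - u')"
    by (simp add: a_def ac_simps)
  have "norm1 (euler_step h p - euler_step h q) = norm (x' - u') + norm ((y + h *\<^sub>R G2 x') - (v + h *\<^sub>R G2 u'))"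
    by (simp add: norm1_def euler_step_def p q x'_def u'_def Let_def)
  also have "\<dots> \<le> (1 + a) * norm (x' - u') + norm (y - v)" using 2 by (simp add: algebra_simps)
  also have "\<dots> \<le> (1 + a) * (norm (x - u) + a * norm (y - v)) + norm (y - v)"
    using 1 a by (intro add_right_mono mult_left_mono) auto
  \<comment> \<open>Each shear costs one factor \<open>1 + a\<close>, because the second one acts on
    the already updated first component.\<close>
  also have "\<dots> \<le> (1 + a)\<^sup>2 * (norm (x - u) + norm (y - v))"
  proof -
    have "0 \<le> (a + a\<^sup>2) * norm (x - u) + a * norm (y - v)" using a by simp
    then show ?thesis by (simp add: algebra_simps power2_eq_square)
  qed
  finally show ?thesis by (simp add: norm1_def p q a_def)
qed

text \<open>The 3 is 1 + 2. In the first component \<open>G1\<close> is frozen at a point at most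
  \<open>C * h\<close> away. In the second, \<open>G2\<close> is evaluated at the updated point,
  which can be \<open>C * h\<close> from the starting value on top of the \<open>C * h\<close>
  travelled by the solution.\<close>

lemma euler_local_error:
  assumes z: "solution_on \<tau> z" and t: "0 \<le> t" "0 \<le> h" "t + h \<le> \<tau>"
  shows "norm1 (z (t + h) - euler_step h (z t)) \<le> 3 * L * C * h\<^sup>2"
proof -
  have dz: "(z has_vector_derivative vfield (z s)) (at s within {t..t'})" if "s \<in> {t..t'}" "t' \<le> t + h" for s t'
    using z that t unfolding solution_on_def
    by (intro has_vector_derivative_within_subset[of z _ s "{0..\<tau>}" "{t..t'}"]) auto
  have d1: "((\<lambda>s. fst (z s)) has_vector_derivative G1 (snd (z s))) (at s within {t..t'})" if "s \<in> {t..t'}" "t' \<le> t + h" for s t'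
    using bounded_linear.has_vector_derivative[OF bounded_linear_fst dz[OF that]] by (simp add: vfield_def)
  have d2: "((\<lambda>s. snd (z s)) has_vector_derivative G2 (fst (z s))) (at s within {t..t'})" if "s \<in> {t..t'}" "t' \<le> t + h" for s t'
    using bounded_linear.has_vector_derivative[OF bounded_linear_snd dz[OF that]] by (simp add: vfield_def)
  have i1: "norm (fst (z s) - fst (z t)) \<le> C * (s - t)" if "s \<in> {t..t+h}" for s
    using has_vector_derivative_bound[of t s "\<lambda>s. fst (z s)" "\<lambda>s. G1 (snd (z s))" 0 C] d1[of _ s] bd1 that by auto
  have i2: "norm (snd (z s) - snd (z t)) \<le> C * (s - t)" if "s \<in> {t..t+h}" for s
    using has_vector_derivative_bound[of t s "\<lambda>s. snd (z s)" "\<lambda>s. G2 (fst (z s))" 0 C] d2[of _ s] bd2 that by auto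
  have i1': "norm (fst (z s) - fst (z t)) \<le> C * h" if "s \<in> {t..t+h}" for s
    using i1[OF that] mult_left_mono[of "s - t" h C] C_nonneg that by simp
  have i2': "norm (snd (z s) - snd (z t)) \<le> C * h" if "s \<in> {t..t+h}" for s
    using i2[OF that] mult_left_mono[of "s - t" h C] C_nonneg that by simp
  define x' where "x' = fst (z t) + h *\<^sub>R G1 (snd (z t))"
  have e1: "norm (fst (z (t+h)) - x') \<le> L * (C * h) * h"
  proof -
    have "norm (G1 (snd (z s)) - G1 (snd (z t))) \<le> L * (C * h)" if "s \<in> {t..t+h}" for s
      using order_trans[OF lip1' mult_left_mono[OF i2'[OF that] L_nonneg]] .
    then have "norm (fst (z (t+h)) - fst (z t) - (t + h - t) *\<^sub>R G1 (snd (z t))) \<le> L * (C * h) * (t + h - t)"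
      using t d1 by (intro has_vector_derivative_bound) auto
    then show ?thesis by (simp add: x'_def algebra_simps)
  qed
  have e2: "norm (snd (z (t+h)) - (snd (z t) + h *\<^sub>R G2 x')) \<le> L * (2 * C * h) * h"
  proof -
    have "norm (G2 (fst (z s)) - G2 x') \<le> L * (2 * C * h)" if s: "s \<in> {t..t+h}" for s
    proof -
      have "norm (h *\<^sub>R G1 (snd (z t))) \<le> C * h"
        using mult_right_mono[OF bd1 t(2)] t by (simp add: mult.commute)
      then have "norm (fst (z s) - x') \<le> 2 * C * h"
        using i1'[OF s] norm_triangle_ineq4[of "fst (z s) - fst (z t)" "h *\<^sub>R G1 (snd (z t))"]
        by (simp add: x'_def algebra_simps)
      from order_trans[OF lip2' mult_left_mono[OF this L_nonneg]] show ?thesis .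
    qed
    then have "norm (snd (z (t+h)) - snd (z t) - (t + h - t) *\<^sub>R G2 x') \<le> L * (2 * C * h) * (t + h - t)"
      using t d2 by (intro has_vector_derivative_bound) auto
    then show ?thesis by (simp add: algebra_simps)
  qed
  have "norm1 (z (t + h) - euler_step h (z t)) = norm (fst (z (t+h)) - x') + norm (snd (z (t+h)) - (snd (z t) + h *\<^sub>R G2 x'))"
    by (simp add: norm1_def euler_step_def x'_def Let_def)
  also have "\<dots> \<le> 3 * L * C * h\<^sup>2" using add_mono[OF e1 e2] by (simp add: power2_eq_square algebra_simps)
  finally show "norm1 (z (t + h) - euler_step h (z t)) \<le> 3 * L * C * h\<^sup>2" .
qed

text \<open>A discrete Gronwall estimate: each of the \<open>k\<close> local errors is amplified at
  most by the \<open>k\<close>-th power of the stability factor.\<close>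

lemma euler_global_error:
  assumes z: "solution_on \<tau> z" and h: "0 \<le> h" and k: "real k * h \<le> \<tau>"
  shows "norm1 ((euler_step h ^^ k) (z 0) - z (real k * h)) \<le> real k * (3 * L * C * h\<^sup>2) * ((1 + h * L)\<^sup>2) ^ k"
  using k
proof (induction k)
  case 0 then show ?case by (simp add: norm1_def)
next
  case (Suc k)
  define E c where "E = 3 * L * C * h\<^sup>2" and "c = (1 + h * L)\<^sup>2"
  have E: "E \<ge> 0" using L_nonneg C_nonneg by (simp add: E_def)
  have c: "c \<ge> 1" using h L_nonneg by (simp add: c_def)
  have kh: "real k * h + h \<le> \<tau>" using Suc.prems by (simp add: algebra_simps)
  let ?p = "(euler_step h ^^ k) (z 0)" and ?s = "real k * h"
  have "norm1 (euler_step h (z ?s) - z (?s + h)) = norm1 (z (?s + h) - euler_step h (z ?s))"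
    by (simp add: norm1_def norm_minus_commute)
  then have "norm1 (euler_step h (z ?s) - z (?s + h)) \<le> E"
    using euler_local_error[OF z, of ?s h] h kh by (simp add: E_def)
  moreover have "norm1 (euler_step h ?p - euler_step h (z ?s)) \<le> c * (real k * E * c ^ k)"
  proof -
    have "norm1 (euler_step h ?p - euler_step h (z ?s)) \<le> c * norm1 (?p - z ?s)"
      unfolding c_def by (rule norm1_euler_step_diff[OF h])
    also have "\<dots> \<le> c * (real k * E * c ^ k)"
      unfolding E_def c_def using kh h by (intro mult_left_mono Suc.IH) auto
    finally show ?thesis .
  qed
  ultimately have "norm1 (euler_step h ?p - z (?s + h)) \<le> c * (real k * E * c ^ k) + E"
    using norm1_triangle[of "euler_step h ?p - euler_step h (z ?s)" "euler_step h (z ?s) - z (?s + h)"] by simp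
  also have "\<dots> \<le> c * (real k * E * c ^ k) + E * c ^ Suc k"
    using E c mult_left_mono[OF one_le_power[OF c, of "Suc k"] E] by simp
  also have "\<dots> = real (Suc k) * E * c ^ Suc k" by (simp add: algebra_simps)
  finally show ?case by (simp add: E_def c_def algebra_simps)
qed

text \<open>The \<open>Suc n\<close> local errors of second order add up to order
  \<open>1 / Suc n\<close>, while the amplification stays below \<open>exp (2 * L * \<tau>)\<close>.
  The iterates depend on \<open>z\<close> through \<open>z 0\<close> alone, whence uniqueness of
  solutions.\<close>

lemma euler_converges:
  assumes z: "solution_on \<tau> z" and \<tau>: "0 \<le> \<tau>"
  shows "(\<lambda>n. (euler_step (\<tau> / real (Suc n)) ^^ Suc n) (z 0)) \<longlonglongrightarrow> z \<tau>"
proof -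
  have bd: "norm ((euler_step (\<tau> / real (Suc n)) ^^ Suc n) (z 0) - z \<tau>) \<le> 3 * L * C * \<tau>\<^sup>2 * exp (2 * L * \<tau>) * inverse (real (Suc n))" for n
  proof -
    define h where "h = \<tau> / real (Suc n)"
    have h: "0 \<le> h" "real (Suc n) * h = \<tau>" using \<tau> by (auto simp: h_def simp del: of_nat_Suc)
    have "((1 + h * L)\<^sup>2) ^ Suc n = (1 + h * L) ^ (2 * Suc n)" by (simp add: power_mult[symmetric] del: power_Suc)
    also have "\<dots> \<le> exp (h * L) ^ (2 * Suc n)"
      using h L_nonneg exp_ge_add_one_self[of "h * L"] by (intro power_mono) auto
    also have "\<dots> = exp (real (2 * Suc n) * (h * L))" by (rule exp_of_nat_mult[symmetric])
    also have "real (2 * Suc n) * (h * L) = 2 * L * (real (Suc n) * h)" by (simp add: algebra_simps)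
    finally have ex: "((1 + h * L)\<^sup>2) ^ Suc n \<le> exp (2 * L * \<tau>)" using h by simp
    have "norm ((euler_step h ^^ Suc n) (z 0) - z (real (Suc n) * h)) \<le> real (Suc n) * (3 * L * C * h\<^sup>2) * ((1 + h * L)\<^sup>2) ^ Suc n"
      using euler_global_error[OF z h(1), of "Suc n"] h(2) norm_le_norm1 order_trans by (metis order_refl)
    also have "\<dots> \<le> real (Suc n) * (3 * L * C * h\<^sup>2) * exp (2 * L * \<tau>)"
      using ex L_nonneg C_nonneg by (intro mult_left_mono) auto
    also have "real (Suc n) * (3 * L * C * h\<^sup>2) = 3 * L * C * \<tau>\<^sup>2 * inverse (real (Suc n))"
      unfolding h_def by (simp add: power2_eq_square field_simps del: of_nat_Suc)
    finally show ?thesis using h by (simp add: h_def algebra_simps del: of_nat_Suc)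
  qed
  have "(\<lambda>n. 3 * L * C * \<tau>\<^sup>2 * exp (2 * L * \<tau>) * inverse (real (Suc n))) \<longlonglongrightarrow> 0"
    using tendsto_mult_right_zero[OF LIMSEQ_inverse_real_of_nat] by blast
  then have "(\<lambda>n. (euler_step (\<tau> / real (Suc n)) ^^ Suc n) (z 0) - z \<tau>) \<longlonglongrightarrow> 0"
    by (rule Lim_null_comparison[rotated]) (use bd in auto)
  then show ?thesis by (rule LIM_zero_cancel)
qed

lemma norm_euler_iter: "0 \<le> h \<Longrightarrow> norm ((euler_step h ^^ k) p - p) \<le> real k * (2 * C * h)"
proof (induction k)
  case (Suc k)
  have *: "norm (euler_step h q - q) \<le> 2 * C * h" for q
  proof -
    have "norm (euler_step h q - q) \<le> norm1 (euler_step h q - q)" by (rule norm_le_norm1)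
    also have "\<dots> = h * norm (G1 (snd q)) + h * norm (G2 (fst q + h *\<^sub>R G1 (snd q)))"
      using Suc.prems by (simp add: norm1_def euler_step_def Let_def)
    also have "\<dots> \<le> h * C + h * C" using Suc.prems bd1 bd2 by (intro add_mono mult_left_mono)
    finally show ?thesis by simp
  qed
  have "norm ((euler_step h ^^ Suc k) p - p) \<le> norm (euler_step h ((euler_step h ^^ k) p) - (euler_step h ^^ k) p) + norm ((euler_step h ^^ k) p - p)"
    using norm_triangle_ineq[of "euler_step h ((euler_step h ^^ k) p) - (euler_step h ^^ k) p" "(euler_step h ^^ k) p - p"] by simp
  with *[of "(euler_step h ^^ k) p"] Suc show ?case by (simp add: algebra_simps)
qed simp

lemma lipschitz_vfield: "(2 * L)-lipschitz_on UNIV vfield"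
proof (rule lipschitz_onI)
  fix p q :: "'a \<times> 'b"
  have "norm (vfield p - vfield q) \<le> norm1 (vfield p - vfield q)" by (rule norm_le_norm1)
  also have "\<dots> \<le> L * norm (snd (p - q)) + L * norm (fst (p - q))"
    unfolding norm1_def vfield_def using add_mono[OF lip1' lip2'] by simp
  also have "\<dots> \<le> L * norm (p - q) + L * norm (p - q)"
    using L_nonneg norm_fst_le[of "fst (p-q)" "snd (p-q)"] norm_snd_le[of "snd (p-q)" "fst (p-q)"]
    unfolding prod.collapse by (intro add_mono mult_left_mono)
  finally show "dist (vfield p) (vfield q) \<le> 2 * L * dist p q" by (simp add: dist_norm)
qed (use L_nonneg in simp)

text \<open>Picard iteration supplies a solution from every point, and its endpoint defines
  \<open>\<phi>\<close>. Euler iterates converge to the endpoint of any solution, which yields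
  measurability, invariance of Lebesgue measure and independence of the chosen solution
  together.\<close>

lemma flow_map_exists:
  obtains \<tau> \<phi> where "0 < \<tau>" "\<phi> \<in> measurable lborel lborel" "distr lborel lborel \<phi> = lborel"
    "\<And>p. \<exists>z. z 0 = p \<and> z \<tau> = \<phi> p \<and> solution_on \<tau> z"
    "\<And>z. solution_on \<tau> z \<Longrightarrow> z \<tau> = \<phi> (z 0)"
proof -
  \<comment> \<open>Short enough for Picard iteration with the Lipschitz constant
    \<open>2 * L\<close> of the whole field; the 1 covers \<open>L = 0\<close>.\<close>
  define \<tau> where "\<tau> = 1 / (2 * L + 1)"
  have \<tau>: "0 < \<tau>" "\<tau> * (2 * L) < 1" using L_nonneg by (auto simp: \<tau>_def field_simps)
  have "\<exists>z. z 0 = p \<and> solution_on \<tau> z" for p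
    using lipschitz_ode_exists[OF lipschitz_vfield \<tau>] unfolding solution_on_def .
  then obtain Z where Z: "\<And>p. Z p 0 = p" "\<And>p. solution_on \<tau> (Z p)" by metis
  define \<phi> where "\<phi> p = Z p \<tau>" for p
  define f where "f n = euler_step (\<tau> / real (Suc n)) ^^ Suc n" for n
  have lim: "(\<lambda>n. f n p) \<longlonglongrightarrow> \<phi> p" for p
    unfolding f_def \<phi>_def using euler_converges[OF Z(2)[of p]] \<tau> by (simp only: Z(1) less_imp_le)
  have bd: "norm (f n p - p) \<le> 2 * C * \<tau>" for n p
    using norm_euler_iter[of "\<tau> / real (Suc n)" "Suc n" p] \<tau>(1) unfolding f_def
    by (simp add: field_simps del: of_nat_Suc funpow.simps)
  have fm: "f n \<in> borel_measurable borel" "distr lborel lborel (f n) = lborel" for n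
    using euler_iter unfolding f_def by (simp_all del: funpow.simps)
  have \<phi>m: "\<phi> \<in> measurable lborel lborel" "distr lborel lborel \<phi> = lborel"
    using limit_lborel_preserving[OF fm lim bd] by simp_all
  have uniq: "z \<tau> = \<phi> (z 0)" if "solution_on \<tau> z" for z
    using LIMSEQ_unique[OF euler_converges[OF that] lim[unfolded f_def]] \<tau> by simp
  show thesis
    using that[of \<tau> \<phi>] \<tau> \<phi>m Z uniq unfolding \<phi>_def by blast
qed

end

section \<open>Mirror maps and zero-sum dynamics\<close>

definition proj_off :: "'a::real_inner \<Rightarrow> 'a \<Rightarrow> 'a" where
  "proj_off e v = v - ((v \<bullet> e) / (e \<bullet> e)) *\<^sub>R e"

lemma bounded_linear_proj_off: "bounded_linear (proj_off e)"
proof -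
  have "bounded_linear (\<lambda>v. v - ((v \<bullet> e) * inverse (e \<bullet> e)) *\<^sub>R e)"
    by (intro bounded_linear_sub bounded_linear_ident bounded_linear_scaleR_left[THEN bounded_linear_compose]
        bounded_linear_mult_left[THEN bounded_linear_compose] bounded_linear_inner_left)
  then show ?thesis unfolding proj_off_def[abs_def] divide_inverse .
qed

lemma proj_off_orthogonal: "proj_off e v \<bullet> e = 0"
  by (cases "e = 0") (simp_all add: proj_off_def inner_diff_left)

lemma norm_proj_off_le: "norm (proj_off e v) \<le> norm v"
proof -
  have "v = proj_off e v + ((v \<bullet> e) / (e \<bullet> e)) *\<^sub>R e" by (simp add: proj_off_def)
  moreover have "orthogonal (proj_off e v) (((v \<bullet> e) / (e \<bullet> e)) *\<^sub>R e)"
    using proj_off_orthogonal[of e v] by (simp add: orthogonal_def)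
  ultimately have "(norm v)\<^sup>2 = (norm (proj_off e v))\<^sup>2 + (norm (((v \<bullet> e) / (e \<bullet> e)) *\<^sub>R e))\<^sup>2"
    using norm_add_Pythagorean by metis
  then show ?thesis by (metis le_add_same_cancel1 norm_ge_zero power2_le_imp_le zero_le_power2)
qed

text \<open>\<open>q_max\<close> joins the argmax property with quadratic growth away from the
  maximiser, the form in which strong convexity is used. The vector \<open>e\<close> is normal to
  the affine hull of \<open>K\<close> (for density matrices the identity, with the trace as inner
  product), and \<open>xs\<close> is a relatively interior point.\<close>

locale mirror_map =
  fixes K :: "'a::euclidean_space set" and h :: "'a \<Rightarrow> real" and q :: "'a \<Rightarrow> 'a" and c :: real
    and e xs :: 'a and \<epsilon> H :: real
  assumes c_pos: "0 < c" and q_in: "\<And>b. q b \<in> K"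
    and q_max: "\<And>b x. x \<in> K \<Longrightarrow> b \<bullet> x - h x + c * (norm (x - q b))\<^sup>2 \<le> b \<bullet> q b - h (q b)"
    and e_const: "\<And>x y. x \<in> K \<Longrightarrow> y \<in> K \<Longrightarrow> x \<bullet> e = y \<bullet> e" and e_nonzero: "e \<noteq> 0"
    and eps_pos: "0 < \<epsilon>" and interior: "\<And>v. v \<bullet> e = 0 \<Longrightarrow> norm v \<le> \<epsilon> \<Longrightarrow> xs + v \<in> K"
    and h_bound: "\<And>x. x \<in> K \<Longrightarrow> h x \<le> H"
begin

definition "conj_h b = b \<bullet> q b - h (q b)"

text \<open>The Fenchel coupling of \<open>b\<close> with the point \<open>xs\<close>, up to the constant \<open>h xs\<close>.\<close>
definition "coupling b = conj_h b - b \<bullet> xs"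

lemma conj_h_ge: "x \<in> K \<Longrightarrow> b \<bullet> x - h x \<le> conj_h b"
  using q_max[of x b] c_pos zero_le_power2[of "norm (x - q b)"] unfolding conj_h_def
  by (smt (verit) mult_nonneg_nonneg)

text \<open>Use the growth condition at each score with the maximiser of the other as competitor and
  add: the values of \<open>h\<close> cancel and the quadratic terms double.\<close>

lemma q_monotone: "2 * c * (norm (q b' - q b))\<^sup>2 \<le> (b' - b) \<bullet> (q b' - q b)"
  using q_max[OF q_in[of b'], of b] q_max[OF q_in[of b], of b']
  by (simp add: norm_minus_commute inner_diff_left inner_diff_right)

lemma q_lipschitz: "norm (q b' - q b) \<le> norm (b' - b) / (2 * c)"
proof (cases "q b' = q b")
  case False
  have "2 * c * (norm (q b' - q b))\<^sup>2 \<le> norm (b' - b) * norm (q b' - q b)"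
    using q_monotone order_trans norm_cauchy_schwarz by blast
  then have "2 * c * norm (q b' - q b) \<le> norm (b' - b)"
    using False by (simp add: power2_eq_square)
  then show ?thesis using c_pos by (simp add: field_simps)
qed (use c_pos in simp)

lemma q_shift: "q (b + s *\<^sub>R e) = q b"
proof -
  have "s * (e \<bullet> q (b + s *\<^sub>R e)) = s * (e \<bullet> q b)"
    using e_const[OF q_in q_in] by (simp add: inner_commute)
  then have "2 * c * (norm (q (b + s *\<^sub>R e) - q b))\<^sup>2 \<le> 0"
    using q_monotone[of "b + s *\<^sub>R e" b] by (auto simp: inner_diff_right)
  then show ?thesis using c_pos by (simp add: mult_le_0_iff)
qed

lemma q_proj_off: "q (b0 + proj_off e (b - b0)) = q b"
  using q_shift[of b "- (((b - b0) \<bullet> e) / (e \<bullet> e))"] by (simp add: proj_off_def)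

text \<open>The envelope theorem. Testing the maximum at \<open>y\<close> with \<open>q b\<close>
  and the one at \<open>b\<close> with \<open>q y\<close> puts the remainder between 0 and
  \<open>(y - b) \<bullet> (q y - q b)\<close>, which the Lipschitz bound makes quadratic in
  \<open>y - b\<close>.\<close>

lemma conj_h_derivative: "(conj_h has_derivative (\<lambda>v. v \<bullet> q b)) (at b)"
proof (rule has_derivativeI_sandwich[where e=1 and H="\<lambda>y. norm (y - b) / (2 * c)"])
  show "bounded_linear (\<lambda>v. v \<bullet> q b)" by (rule bounded_linear_inner_left)
  show "((\<lambda>y. norm (y - b) / (2 * c)) \<longlongrightarrow> 0) (at b)"
    by (rule tendsto_eq_intros refl | use c_pos in simp)+
  fix y assume "y \<noteq> b"
  have "0 \<le> conj_h y - conj_h b - (y - b) \<bullet> q b"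
    using conj_h_ge[OF q_in[of b], of y] by (simp add: conj_h_def inner_diff_left)
  moreover have "conj_h y - conj_h b - (y - b) \<bullet> q b \<le> (y - b) \<bullet> (q y - q b)"
    using conj_h_ge[OF q_in[of y], of b] by (simp add: conj_h_def inner_diff_left inner_diff_right)
  moreover have "(y - b) \<bullet> (q y - q b) \<le> norm (y - b) * (norm (y - b) / (2 * c))"
    using norm_cauchy_schwarz[of "y - b" "q y - q b"] mult_left_mono[OF q_lipschitz[of y b], of "norm (y - b)"] by simp
  ultimately have "norm (conj_h y - conj_h b - (y - b) \<bullet> q b) \<le> norm (y - b) * (norm (y - b) / (2 * c))"
    by simp
  then show "norm (conj_h y - conj_h b - (y - b) \<bullet> q b) / norm (y - b) \<le> norm (y - b) / (2 * c)"
    using \<open>y \<noteq> b\<close> by (simp add: divide_le_eq ac_simps)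
qed simp

lemma coupling_derivative: "(coupling has_derivative (\<lambda>v. v \<bullet> (q b - xs))) (at b)"
  unfolding coupling_def[abs_def] inner_diff_right
  by (intro has_derivative_diff conj_h_derivative has_derivative_inner_left has_derivative_ident)

lemma continuous_coupling: "continuous_on UNIV coupling"
  by (intro has_derivative_continuous_on[where f'="\<lambda>b v. v \<bullet> (q b - xs)"])
    (use coupling_derivative in auto)

lemma xs_in: "xs \<in> K" using interior[of 0] eps_pos by simp

text \<open>Coercivity: in the supremum that defines the conjugate, the competitor
  \<open>xs + v\<close> with \<open>v\<close> of length \<open>\<epsilon>\<close> along the
  projected score gains \<open>\<epsilon>\<close> times the norm of that projection. If the
  projection vanishes, division by zero makes \<open>v\<close> zero, which is harmless.\<close>

lemma coupling_ge: "\<epsilon> * norm (proj_off e b) - H \<le> coupling b"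
proof -
  define v where "v = (\<epsilon> / norm (proj_off e b)) *\<^sub>R proj_off e b"
  have "v \<bullet> e = 0" by (simp add: v_def proj_off_orthogonal)
  moreover have "norm v \<le> \<epsilon>" using eps_pos by (simp add: v_def)
  ultimately have K: "xs + v \<in> K" by (rule interior)
  have "b \<bullet> v = \<epsilon> * norm (proj_off e b)"
  proof -
    have "b \<bullet> proj_off e b = proj_off e b \<bullet> proj_off e b"
      using proj_off_orthogonal[of e b] unfolding proj_off_def[of e b]
      by (simp add: inner_diff_left inner_commute)
    then show ?thesis by (simp add: v_def power2_norm_eq_inner[symmetric] power2_eq_square)
  qed
  with conj_h_ge[OF K, of b] h_bound[OF K] show ?thesis
    by (simp add: coupling_def inner_add_right)
qed

lemma norm_le_coupling: "norm b \<le> (coupling b + H) / \<epsilon> + \<bar>b \<bullet> e\<bar> / norm e"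
proof -
  have "norm b \<le> norm (proj_off e b) + norm (((b \<bullet> e) / (e \<bullet> e)) *\<^sub>R e)"
    using norm_triangle_ineq[of "proj_off e b" "((b \<bullet> e) / (e \<bullet> e)) *\<^sub>R e"] by (simp add: proj_off_def)
  moreover have "norm (((b \<bullet> e) / (e \<bullet> e)) *\<^sub>R e) = \<bar>b \<bullet> e\<bar> / norm e"
    using e_nonzero by (simp add: power2_norm_eq_inner[symmetric] power2_eq_square)
  moreover have "norm (proj_off e b) \<le> (coupling b + H) / \<epsilon>"
    using coupling_ge[of b] eps_pos by (simp add: field_simps)
  ultimately show ?thesis by simp
qed

lemma coupling_lower: "- H \<le> coupling b"
  using coupling_ge[of b] eps_pos by (smt (verit) mult_nonneg_nonneg norm_ge_zero)

end

locale zero_sum_game =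
  p1: mirror_map K1 h1 q1 c1 e1 x1s \<epsilon>1 H1 + p2: mirror_map K2 h2 q2 c2 e2 x2s \<epsilon>2 H2
  for K1 :: "'a::euclidean_space set" and h1 q1 c1 e1 x1s \<epsilon>1 H1
    and K2 :: "'b::euclidean_space set" and h2 q2 c2 e2 x2s \<epsilon>2 H2 +
  fixes M :: "'b \<Rightarrow> 'a" and N :: "'a \<Rightarrow> 'b"
  assumes M: "bounded_linear M" and N: "bounded_linear N"
    and K1: "bounded K1" and K2: "bounded K2"
    and zero_sum: "\<And>x y. x \<in> K1 \<Longrightarrow> y \<in> K2 \<Longrightarrow> x \<bullet> M y + y \<bullet> N x = 0"
    and equilibrium: "\<And>x y. x \<in> K1 \<Longrightarrow> y \<in> K2 \<Longrightarrow> x1s \<bullet> M y + x2s \<bullet> N x = 0"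
begin

text \<open>The projected field moves the score variables only along directions that the mirror maps see;
  it has the same primal orbits but bounded sublevel sets of the conserved quantity.\<close>
definition "G1 y = proj_off e1 (M (q2 y))"
definition "G2 x = proj_off e2 (N (q1 x))"

definition "energy p = p1.coupling (fst p) + p2.coupling (snd p)"

text \<open>The energy is invariant under shifts along \<open>e1\<close> and \<open>e2\<close>, so
  its sublevel sets are unbounded cylinders; two further coordinates, conserved by the projected
  field, cut them down to bounded sets.\<close>

definition "region R = {p. energy p \<le> R \<and> \<bar>fst p \<bullet> e1\<bar> \<le> R \<and> \<bar>snd p \<bullet> e2\<bar> \<le> R}"

lemma skew_field_exists: "\<exists>L C. skew_field G1 G2 L C"
proof -
  have lin: "\<exists>A\<ge>0. \<forall>v. norm (proj_off e (T v)) \<le> A * norm v \<and> proj_off e (T v) - proj_off e (T w) = proj_off e (T (v - w))"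
    if T: "bounded_linear T" for T :: "'c::euclidean_space \<Rightarrow> 'd::euclidean_space" and e w
  proof -
    obtain A where "A \<ge> 0" "\<forall>v. norm (T v) \<le> norm v * A"
      using bounded_linear.nonneg_bounded[OF T] by blast
    then show ?thesis
      using norm_proj_off_le[of e] order_trans
      by (intro exI[of _ A]) (auto simp: mult.commute linear_diff[OF bounded_linear.linear[OF T]]
          linear_diff[OF bounded_linear.linear[OF bounded_linear_proj_off]] intro: order_trans)
  qed
  obtain A where A: "A \<ge> 0" "\<And>v. norm (proj_off e1 (M v)) \<le> A * norm v" using lin[OF M] by blast
  obtain B where B: "B \<ge> 0" "\<And>v. norm (proj_off e2 (N v)) \<le> B * norm v" using lin[OF N] by blast
  have dM: "proj_off e1 (M v) - proj_off e1 (M w) = proj_off e1 (M (v - w))" for v w using lin[OF M, of e1 w] by blast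
  have dN: "proj_off e2 (N v) - proj_off e2 (N w) = proj_off e2 (N (v - w))" for v w using lin[OF N, of e2 w] by blast
  obtain r1 r2 where r: "\<And>x. x \<in> K1 \<Longrightarrow> norm x \<le> r1" "\<And>y. y \<in> K2 \<Longrightarrow> norm y \<le> r2"
    using K1 K2 unfolding bounded_iff by blast
  define L where "L = max (A / (2 * c2)) (B / (2 * c1))"
  define C where "C = max (A * r2) (B * r1)"
  have L: "L \<ge> 0" using A(1) p2.c_pos by (simp add: L_def le_max_iff_disj)
  have "norm (G1 y - G1 y') \<le> L * norm (y - y')" for y y'
  proof -
    have "norm (G1 y - G1 y') \<le> A * norm (q2 y - q2 y')" unfolding G1_def dM by (rule A)
    also have "\<dots> \<le> A * (norm (y - y') / (2 * c2))" using A by (intro mult_left_mono p2.q_lipschitz)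
    also have "\<dots> = A / (2 * c2) * norm (y - y')" by simp
    also have "\<dots> \<le> L * norm (y - y')" unfolding L_def by (intro mult_right_mono) auto
    finally show ?thesis .
  qed
  moreover have "norm (G2 x - G2 x') \<le> L * norm (x - x')" for x x'
  proof -
    have "norm (G2 x - G2 x') \<le> B * norm (q1 x - q1 x')" unfolding G2_def dN by (rule B)
    also have "\<dots> \<le> B * (norm (x - x') / (2 * c1))" using B by (intro mult_left_mono p1.q_lipschitz)
    also have "\<dots> = B / (2 * c1) * norm (x - x')" by simp
    also have "\<dots> \<le> L * norm (x - x')" unfolding L_def by (intro mult_right_mono) auto
    finally show ?thesis .
  qed
  moreover have "norm (G1 y) \<le> C" for y
    using order_trans[OF A(2) mult_left_mono[OF r(2)[OF p2.q_in[of y]] A(1)]] by (simp add: G1_def C_def le_max_iff_disj)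
  moreover have "norm (G2 x) \<le> C" for x
    using order_trans[OF B(2) mult_left_mono[OF r(1)[OF p1.q_in[of x]] B(1)]] by (simp add: G2_def C_def le_max_iff_disj)
  ultimately have "skew_field G1 G2 L C"
    using L by unfold_locales (auto intro!: lipschitz_onI simp: dist_norm)
  then show ?thesis by blast
qed

lemma inner_proj_off1: "x \<in> K1 \<Longrightarrow> proj_off e1 v \<bullet> (x - x1s) = v \<bullet> (x - x1s)"
  using p1.e_const[OF _ p1.xs_in, of x] by (simp add: proj_off_def inner_diff_left inner_diff_right inner_commute)

lemma inner_proj_off2: "y \<in> K2 \<Longrightarrow> proj_off e2 v \<bullet> (y - x2s) = v \<bullet> (y - x2s)"
  using p2.e_const[OF _ p2.xs_in, of y] by (simp add: proj_off_def inner_diff_left inner_diff_right inner_commute)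

text \<open>Differences within \<open>K1\<close> and \<open>K2\<close> are orthogonal to
  \<open>e1\<close> and \<open>e2\<close>, so the projections drop out. Of the four remaining
  pairings, the two at the current strategies cancel by \<open>zero_sum\<close>, the two at the
  equilibrium by \<open>equilibrium\<close>.\<close>

lemma energy_rate: "G1 y \<bullet> (q1 x - x1s) + G2 x \<bullet> (q2 y - x2s) = 0"
  using zero_sum[OF p1.q_in[of x] p2.q_in[of y]] equilibrium[OF p1.q_in[of x] p2.q_in[of y]]
  by (simp add: G1_def G2_def inner_proj_off1[OF p1.q_in] inner_proj_off2[OF p2.q_in])
    (simp add: inner_diff_right inner_commute)

lemma conserved:
  assumes z: "\<And>t. t \<in> {0..\<tau>} \<Longrightarrow> (z has_vector_derivative (G1 (snd (z t)), G2 (fst (z t)))) (at t within {0..\<tau>})"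
    and \<tau>: "0 \<le> \<tau>"
  shows "energy (z \<tau>) = energy (z 0)" "fst (z \<tau>) \<bullet> e1 = fst (z 0) \<bullet> e1" "snd (z \<tau>) \<bullet> e2 = snd (z 0) \<bullet> e2"
proof -
  have d1: "((\<lambda>t. fst (z t)) has_derivative (\<lambda>h. h *\<^sub>R G1 (snd (z t)))) (at t within {0..\<tau>})" if "t \<in> {0..\<tau>}" for t
    using bounded_linear.has_vector_derivative[OF bounded_linear_fst z[OF that]] by (simp add: has_vector_derivative_def)
  have d2: "((\<lambda>t. snd (z t)) has_derivative (\<lambda>h. h *\<^sub>R G2 (fst (z t)))) (at t within {0..\<tau>})" if "t \<in> {0..\<tau>}" for t
    using bounded_linear.has_vector_derivative[OF bounded_linear_snd z[OF that]] by (simp add: has_vector_derivative_def)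
  have const: "f \<tau> = f 0" if "\<And>t. t \<in> {0..\<tau>} \<Longrightarrow> (f has_derivative (\<lambda>h. 0)) (at t within {0..\<tau>})" for f :: "real \<Rightarrow> real"
    using has_derivative_zero_unique[of "{0..\<tau>}" f 0 \<tau>] that \<tau> by simp
  show "energy (z \<tau>) = energy (z 0)"
  proof (rule const)
    fix t assume t: "t \<in> {0..\<tau>}"
    have "((\<lambda>t. energy (z t)) has_derivative
        (\<lambda>h. (h *\<^sub>R G1 (snd (z t))) \<bullet> (q1 (fst (z t)) - x1s) + (h *\<^sub>R G2 (fst (z t))) \<bullet> (q2 (snd (z t)) - x2s))) (at t within {0..\<tau>})"
      unfolding energy_def
      by (intro has_derivative_add has_derivative_compose[OF d1[OF t] p1.coupling_derivative]
          has_derivative_compose[OF d2[OF t] p2.coupling_derivative])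
    moreover have "(h *\<^sub>R G1 (snd (z t))) \<bullet> (q1 (fst (z t)) - x1s) + (h *\<^sub>R G2 (fst (z t))) \<bullet> (q2 (snd (z t)) - x2s) = 0" for h
      using energy_rate[of "snd (z t)" "fst (z t)"] by (metis distrib_left inner_scaleR_left mult_zero_right)
    ultimately show "((\<lambda>t. energy (z t)) has_derivative (\<lambda>h. 0)) (at t within {0..\<tau>})" by simp
  qed
  show "fst (z \<tau>) \<bullet> e1 = fst (z 0) \<bullet> e1"
  proof (rule const)
    fix t assume t: "t \<in> {0..\<tau>}"
    show "((\<lambda>t. fst (z t) \<bullet> e1) has_derivative (\<lambda>h. 0)) (at t within {0..\<tau>})"
      using has_derivative_inner_left[OF d1[OF t], of e1] by (simp add: G1_def proj_off_orthogonal)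
  qed
  show "snd (z \<tau>) \<bullet> e2 = snd (z 0) \<bullet> e2"
  proof (rule const)
    fix t assume t: "t \<in> {0..\<tau>}"
    show "((\<lambda>t. snd (z t) \<bullet> e2) has_derivative (\<lambda>h. 0)) (at t within {0..\<tau>})"
      using has_derivative_inner_left[OF d2[OF t], of e2] by (simp add: G2_def proj_off_orthogonal)
  qed
qed

lemma continuous_energy: "continuous_on UNIV energy"
  unfolding energy_def[abs_def]
  by (intro continuous_intros continuous_on_compose2[OF p1.continuous_coupling] continuous_on_compose2[OF p2.continuous_coupling]) auto

lemma closed_region: "closed (region R)"
  unfolding region_def
  by (intro closed_Collect_conj closed_Collect_le continuous_intros continuous_energy)

text \<open>Each coupling is bounded below, so a bound on the sum bounds both from above, and
  coercivity applies to each.\<close>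

lemma bounded_region: "bounded (region R)"
proof (rule boundedI)
  fix p assume p: "p \<in> region R"
  have "norm (fst p) \<le> (R + H2 + H1) / \<epsilon>1 + R / norm e1"
  proof -
    have "p1.coupling (fst p) \<le> R + H2" using p p2.coupling_lower[of "snd p"] by (simp add: region_def energy_def)
    then have "(p1.coupling (fst p) + H1) / \<epsilon>1 \<le> (R + H2 + H1) / \<epsilon>1" using p1.eps_pos by (intro divide_right_mono) auto
    moreover have "\<bar>fst p \<bullet> e1\<bar> / norm e1 \<le> R / norm e1" using p by (intro divide_right_mono) (auto simp: region_def)
    ultimately show ?thesis using p1.norm_le_coupling[of "fst p"] by linarith
  qed
  moreover have "norm (snd p) \<le> (R + H1 + H2) / \<epsilon>2 + R / norm e2"
  proof -
    have "p2.coupling (snd p) \<le> R + H1" using p p1.coupling_lower[of "fst p"] by (simp add: region_def energy_def)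
    then have "(p2.coupling (snd p) + H2) / \<epsilon>2 \<le> (R + H1 + H2) / \<epsilon>2" using p2.eps_pos by (intro divide_right_mono) auto
    moreover have "\<bar>snd p \<bullet> e2\<bar> / norm e2 \<le> R / norm e2" using p by (intro divide_right_mono) (auto simp: region_def)
    ultimately show ?thesis using p2.norm_le_coupling[of "snd p"] by linarith
  qed
  ultimately show "norm p \<le> ((R + H2 + H1) / \<epsilon>1 + R / norm e1) + ((R + H1 + H2) / \<epsilon>2 + R / norm e2)"
    using norm_Pair_le[of "fst p" "snd p"] by simp
qed

lemma region_cover: "\<exists>n::nat. p \<in> region (real n)"
proof -
  obtain n :: nat where "max (energy p) (max \<bar>fst p \<bullet> e1\<bar> \<bar>snd p \<bullet> e2\<bar>) \<le> real n" using real_arch_simple by blast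
  then show ?thesis by (auto simp: region_def)
qed

text \<open>The quantifier over \<open>z\<close> stands inside \<open>AE\<close>: the exceptional
  set comes from \<open>\<phi>\<close> alone and precedes the choice of a solution of the original,
  unprojected dynamics.\<close>

theorem recurrence:
  "AE a in lborel. \<forall>z. z 0 = a \<and> (\<forall>t\<ge>0. (z has_vector_derivative (M (q2 (snd (z t))), N (q1 (fst (z t))))) (at t within {0..})) \<longrightarrow>
     (\<exists>t::nat \<Rightarrow> real. strict_mono t \<and> filterlim t at_top sequentially \<and>
        ((\<lambda>n. q1 (fst (z (t n)))) \<longlonglongrightarrow> q1 (fst a)) \<and> ((\<lambda>n. q2 (snd (z (t n)))) \<longlonglongrightarrow> q2 (snd a)))"
proof -
  obtain L C where "skew_field G1 G2 L C" using skew_field_exists by blast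
  then interpret skew_field G1 G2 L C .
  obtain \<tau> \<phi> where \<tau>: "0 < \<tau>" and \<phi>: "\<phi> \<in> measurable lborel lborel" "distr lborel lborel \<phi> = lborel"
    and ex: "\<And>p. \<exists>z. z 0 = p \<and> z \<tau> = \<phi> p \<and> solution_on \<tau> z"
    and uniq: "\<And>z. solution_on \<tau> z \<Longrightarrow> z \<tau> = \<phi> (z 0)"
    using flow_map_exists by metis
  have inv: "\<phi> p \<in> region R \<longleftrightarrow> p \<in> region R" for p R
  proof -
    obtain z where z: "z 0 = p" "z \<tau> = \<phi> p" "solution_on \<tau> z" using ex by blast
    have "energy (\<phi> p) = energy p" "fst (\<phi> p) \<bullet> e1 = fst p \<bullet> e1" "snd (\<phi> p) \<bullet> e2 = snd p \<bullet> e2"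
      using conserved[of \<tau> z] z \<tau> by (auto simp: solution_on_def vfield_def)
    then show ?thesis by (simp add: region_def)
  qed
  have "AE p in lborel. \<forall>n::nat. p \<in> region (real n) \<longrightarrow>
      (\<exists>r::nat\<Rightarrow>nat. strict_mono r \<and> (\<lambda>n. (\<phi> ^^ r n) p) \<longlonglongrightarrow> p)"
    unfolding AE_all_countable
    using closed_region bounded_region
    by (intro allI poincare_recurrence \<phi> inv emeasure_bounded_finite) (auto simp: borel_closed)
  then show ?thesis
  proof (rule AE_mp, intro AE_I2 impI allI, elim conjE)
    fix a z
    assume rec: "\<forall>n::nat. a \<in> region (real n) \<longrightarrow> (\<exists>r::nat\<Rightarrow>nat. strict_mono r \<and> (\<lambda>n. (\<phi> ^^ r n) a) \<longlonglongrightarrow> a)"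
      and z0: "z 0 = a"
      and z: "\<forall>t\<ge>0. (z has_vector_derivative (M (q2 (snd (z t))), N (q1 (fst (z t))))) (at t within {0..})"
    obtain r :: "nat \<Rightarrow> nat" where r: "strict_mono r" "(\<lambda>n. (\<phi> ^^ r n) a) \<longlonglongrightarrow> a"
      using rec region_cover[of a] by blast
    \<comment> \<open>The displacement from \<open>a\<close> loses its components along
      \<open>e1\<close> and \<open>e2\<close>. The mirror maps do not notice, so \<open>w\<close>
      has the primal orbit of \<open>z\<close>, and its velocity is the projected field at
      \<open>w\<close> itself.\<close>
    define w where "w t = (fst a + proj_off e1 (fst (z t) - fst a), snd a + proj_off e2 (snd (z t) - snd a))" for t
    have qw: "q1 (fst (w t)) = q1 (fst (z t))" "q2 (snd (w t)) = q2 (snd (z t))" for t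
      by (simp_all add: w_def p1.q_proj_off p2.q_proj_off)
    have w0: "w 0 = a" by (simp add: w_def z0 proj_off_def)
    have dw: "(w has_vector_derivative vfield (w t)) (at t within {0..})" if "t \<ge> 0" for t
    proof -
      note dz = z[rule_format, OF that]
      have "((\<lambda>t. proj_off e1 (fst (z t) - fst a)) has_vector_derivative proj_off e1 (M (q2 (snd (z t))) - 0)) (at t within {0..})"
        using bounded_linear.has_vector_derivative[OF bounded_linear_fst dz]
        by (intro bounded_linear.has_vector_derivative[OF bounded_linear_proj_off] has_vector_derivative_diff) auto
      moreover have "((\<lambda>t. proj_off e2 (snd (z t) - snd a)) has_vector_derivative proj_off e2 (N (q1 (fst (z t))) - 0)) (at t within {0..})"
        using bounded_linear.has_vector_derivative[OF bounded_linear_snd dz]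
        by (intro bounded_linear.has_vector_derivative[OF bounded_linear_proj_off] has_vector_derivative_diff) auto
      ultimately have "(w has_vector_derivative (0 + proj_off e1 (M (q2 (snd (z t))) - 0), 0 + proj_off e2 (N (q1 (fst (z t))) - 0))) (at t within {0..})"
        unfolding w_def[abs_def] by (intro has_vector_derivative_Pair has_vector_derivative_add) auto
      then show ?thesis by (simp add: vfield_def G1_def G2_def qw)
    qed
    have iter: "w (real n * \<tau>) = (\<phi> ^^ n) a" for n
    proof (induction n)
      case (Suc n)
      have "solution_on \<tau> (\<lambda>s. w (real n * \<tau> + s))"
        unfolding solution_on_def
      proof
        fix s assume s: "s \<in> {0..\<tau>}"
        have "(w \<circ> (\<lambda>s. real n * \<tau> + s) has_vector_derivative 1 *\<^sub>R vfield (w (real n * \<tau> + s))) (at s within {0..\<tau>})"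
        proof (rule vector_diff_chain_within)
          show "((+) (real n * \<tau>) has_vector_derivative 1) (at s within {0..\<tau>})"
            by (auto intro!: derivative_eq_intros)
          show "(w has_vector_derivative vfield (w (real n * \<tau> + s))) (at (real n * \<tau> + s) within (+) (real n * \<tau>) ` {0..\<tau>})"
            using \<tau> s by (intro has_vector_derivative_within_subset[OF dw]) auto
        qed
        then show "((\<lambda>s. w (real n * \<tau> + s)) has_vector_derivative vfield (w (real n * \<tau> + s))) (at s within {0..\<tau>})"
          by (simp add: o_def)
      qed
      from uniq[OF this] Suc show ?case by (simp add: algebra_simps)
    qed (simp add: w0)
    define t where "t n = real (r n) * \<tau>" for n
    have "strict_mono t" using r(1) \<tau> by (auto simp: strict_mono_def t_def)
    moreover have "filterlim t at_top sequentially"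
      unfolding t_def
      by (rule filterlim_tendsto_pos_mult_at_top[OF tendsto_const \<tau>, THEN filterlim_cong[OF refl refl, THEN iffD1, rotated]])
        (auto simp: mult.commute intro!: filterlim_compose[OF filterlim_real_sequentially] filterlim_subseq r)
    moreover have lim: "(\<lambda>n. w (t n)) \<longlonglongrightarrow> a" using r(2) by (simp add: t_def iter)
    moreover have "isCont q1 x" for x
    proof -
      have "(1 / (2 * c1))-lipschitz_on UNIV q1"
        using p1.q_lipschitz p1.c_pos by (intro lipschitz_onI) (auto simp: dist_norm)
      then show ?thesis using lipschitz_on_continuous_on continuous_on_eq_continuous_at open_UNIV by blast
    qed
    moreover have "isCont q2 x" for x
    proof -
      have "(1 / (2 * c2))-lipschitz_on UNIV q2"
        using p2.q_lipschitz p2.c_pos by (intro lipschitz_onI) (auto simp: dist_norm)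
      then show ?thesis using lipschitz_on_continuous_on continuous_on_eq_continuous_at open_UNIV by blast
    qed
    ultimately show "\<exists>t::nat \<Rightarrow> real. strict_mono t \<and> filterlim t at_top sequentially \<and>
        ((\<lambda>n. q1 (fst (z (t n)))) \<longlonglongrightarrow> q1 (fst a)) \<and> ((\<lambda>n. q2 (snd (z (t n)))) \<longlonglongrightarrow> q2 (snd a))"
      using isCont_tendsto_compose[of "fst a" q1 "\<lambda>n. fst (w (t n))"] isCont_tendsto_compose[of "snd a" q2 "\<lambda>n. snd (w (t n))"]
        tendsto_fst[OF lim] tendsto_snd[OF lim] qw by auto
  qed
qed

end

section \<open>Hermitian matrices\<close>

text \<open>Maximise the Rayleigh quotient over the unit sphere of \<open>W\<close>. The residual
  \<open>y = A x - l *\<^sub>R x\<close> is an admissible direction; moving by \<open>t\<close>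
  along it and comparing first and second order terms gives
  \<open>2 * (y \<bullet> y) \<le> t * B\<close> for every \<open>t > 0\<close>, so it
  vanishes.\<close>

lemma selfadjoint_eigenvector:
  fixes A :: "'a::euclidean_space \<Rightarrow> 'a"
  assumes lin: "linear A" and sa: "\<And>x y. A x \<bullet> y = x \<bullet> A y"
    and W: "subspace W" "\<And>x. x \<in> W \<Longrightarrow> A x \<in> W" and w: "w \<in> W" "w \<noteq> 0"
  obtains x l where "x \<in> W" "norm x = 1" "A x = l *\<^sub>R x"
proof -
  have contA: "continuous_on S A" for S by (rule linear_continuous_on) (use lin in \<open>simp add: linear_conv_bounded_linear\<close>)
  have "compact (sphere 0 1 \<inter> W)" by (intro compact_Int_closed closed_subspace W) simp
  moreover have "(1 / norm w) *\<^sub>R w \<in> sphere 0 1 \<inter> W" using W w by (simp add: subspace_scale)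
  moreover have "continuous_on (sphere 0 1 \<inter> W) (\<lambda>x. x \<bullet> A x)" by (intro continuous_intros contA)
  ultimately obtain x where x: "x \<in> sphere 0 1 \<inter> W" and max: "\<And>y. y \<in> sphere 0 1 \<inter> W \<Longrightarrow> y \<bullet> A y \<le> x \<bullet> A x"
    using continuous_attains_sup[of "sphere 0 1 \<inter> W" "\<lambda>x. x \<bullet> A x"] by blast
  define l where "l = x \<bullet> A x"
  have x1: "x \<bullet> x = 1" using x by (simp add: dot_square_norm)
  have ray: "y \<bullet> A y \<le> l * (y \<bullet> y)" if "y \<in> W" for y
  proof (cases "y = 0")
    case False
    have "(1 / norm y) *\<^sub>R y \<in> sphere 0 1 \<inter> W" using W that False by (simp add: subspace_scale)
    from max[OF this] have "(y \<bullet> A y) / (norm y)\<^sup>2 \<le> l"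
      by (simp add: l_def linear_cmul[OF lin] power2_eq_square)
    then show ?thesis using False by (simp add: divide_le_eq power2_norm_eq_inner)
  qed (simp add: linear_0[OF lin])
  define y where "y = A x - l *\<^sub>R x"
  have yW: "y \<in> W" using W x by (simp add: y_def subspace_diff subspace_scale)
  define B where "B = l * (y \<bullet> y) - y \<bullet> A y"
  have le: "2 * (y \<bullet> y) \<le> t * B" if t: "t > 0" for t
  proof -
    have "(x + t *\<^sub>R y) \<bullet> A (x + t *\<^sub>R y) \<le> l * ((x + t *\<^sub>R y) \<bullet> (x + t *\<^sub>R y))"
      using W x yW by (intro ray subspace_add subspace_scale) auto
    also have "(x + t *\<^sub>R y) \<bullet> A (x + t *\<^sub>R y) = l + 2 * t * (y \<bullet> A x) + t\<^sup>2 * (y \<bullet> A y)"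
      using sa[of x y] by (simp add: linear_add[OF lin] linear_cmul[OF lin] inner_add_left inner_add_right l_def
          inner_commute power2_eq_square)
    also have "(x + t *\<^sub>R y) \<bullet> (x + t *\<^sub>R y) = 1 + 2 * t * (y \<bullet> x) + t\<^sup>2 * (y \<bullet> y)"
      by (simp add: inner_add_left inner_add_right x1 inner_commute power2_eq_square)
    also have "y \<bullet> A x = y \<bullet> y + l * (y \<bullet> x)" by (simp add: y_def inner_diff_right)
    finally have "t * (2 * (y \<bullet> y)) \<le> t * (t * B)"
      by (simp add: B_def algebra_simps power2_eq_square)
    then show ?thesis using t by simp
  qed
  have "y \<bullet> y \<le> 0"
  proof (rule ccontr)
    assume "\<not> y \<bullet> y \<le> 0"
    then have pos: "y \<bullet> y > 0" by (simp only: not_le)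
    \<comment> \<open>Small enough that \<open>t * B\<close> is at most
      \<open>y \<bullet> y\<close>; the added 1 keeps the denominator positive.\<close>
    define t where "t = (y \<bullet> y) / (\<bar>B\<bar> + 1)"
    have "t > 0" using pos by (simp add: t_def add_nonneg_pos)
    have "t * B \<le> t * (\<bar>B\<bar> + 1)" using \<open>t > 0\<close> by (intro mult_left_mono) auto
    also have "\<dots> = y \<bullet> y" unfolding t_def using abs_ge_zero[of B] by (simp add: field_simps)
    finally show False using le[OF \<open>t > 0\<close>] pos by simp
  qed
  then have "y = 0" by (simp add: inner_gt_zero_iff antisym_conv)
  then show thesis using that[of x l] x by (simp add: y_def)
qed

section \<open>Hermitian inner product and spectral theorem\<close>

definition cip :: "complex^'n \<Rightarrow> complex^'n \<Rightarrow> complex" where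
  "cip x y = (\<Sum>i\<in>UNIV. cnj (x $ i) * y $ i)"

lemma inner_eq_cip: "x \<bullet> y = Re (cip x y)"
  by (simp add: inner_vec_def cip_def inner_complex_def)

lemma cip_self: "cip x x = of_real ((norm x)\<^sup>2)"
proof -
  have "Im (cip x x) = 0" by (simp add: cip_def)
  moreover have "Re (cip x x) = (norm x)\<^sup>2" by (simp add: inner_eq_cip[symmetric] power2_norm_eq_inner)
  ultimately show ?thesis by (simp add: complex_eq_iff)
qed

lemma cip_scale: "cip (c *s x) y = cnj c * cip x y" "cip x (c *s y) = c * cip x y"
  by (simp_all add: cip_def sum_distrib_left algebra_simps)

lemma cip_add: "cip x (y + z) = cip x y + cip x z"
  by (simp add: cip_def distrib_left sum.distrib)

lemma cip_commute: "cip y x = cnj (cip x y)"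
  by (simp add: cip_def mult.commute)

lemma cquad_eq_cip: "cquad A x = cip x (A *v x)"
  by (simp add: cquad_def cip_def)

lemma cip_cadj: "cip x (A *v y) = cip (cadj A *v x) y"
proof -
  have "cip x (A *v y) = (\<Sum>i\<in>UNIV. \<Sum>j\<in>UNIV. cnj (x $ i) * A $ i $ j * y $ j)"
    by (simp add: cip_def matrix_vector_mult_def sum_distrib_left mult.assoc)
  also have "\<dots> = (\<Sum>j\<in>UNIV. \<Sum>i\<in>UNIV. cnj (x $ i) * A $ i $ j * y $ j)" by (rule sum.swap)
  also have "\<dots> = cip (cadj A *v x) y"
    by (simp add: cip_def matrix_vector_mult_def cadj_def sum_distrib_right sum_distrib_left ac_simps)
  finally show ?thesis .
qed

lemma cadj_cadj [simp]: "cadj (cadj A) = A"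
  by (simp add: cadj_def vec_eq_iff)

lemma cadj_matrix_mul: "cadj (A ** B) = cadj B ** cadj A"
  by (simp add: cadj_def matrix_matrix_mult_def vec_eq_iff mult.commute)

lemma linear_matrix_vector_complex: "linear ((*v) (A :: complex^'n^'n))"
  by (rule linearI)
    (simp_all add: vec_eq_iff matrix_vector_mult_def scaleR_sum_right distrib_left sum.distrib)

text \<open>Induction on the set of indices: the complex orthogonal complement of the eigenvectors
  found so far is invariant under \<open>X\<close>, and \<open>selfadjoint_eigenvector\<close>
  supplies a further one in it, the real inner product being the real part of
  \<open>cip\<close>.\<close>

lemma orthonormal_eigenvectors:
  fixes X :: "complex^'n^'n"
    and S :: "'n set"
  assumes X: "hermitian X"
  shows "\<exists>u l. (\<forall>k\<in>S. X *v u k = complex_of_real (l k) *s u k) \<and>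
     (\<forall>j\<in>S. \<forall>k\<in>S. cip (u j) (u k) = of_bool (j = k))"
proof (induction S rule: finite_induct[OF finite])
  case 1 show ?case by simp
next
  case (2 k0 S)
  then obtain u l where u: "\<And>k. k \<in> S \<Longrightarrow> X *v u k = complex_of_real (l k) *s u k"
    and o: "\<And>j k. j \<in> S \<Longrightarrow> k \<in> S \<Longrightarrow> cip (u j) (u k) = of_bool (j = k)" by blast
  define W where "W = {x. \<forall>j\<in>S. cip (u j) x = 0}"
  have scaleR_scale: "r *\<^sub>R x = complex_of_real r *s x" for r and x :: "complex^'n"
    by (rule vec_eq_iff[THEN iffD2]) (simp add: scaleR_conv_of_real[of r "x $ _"])
  have W: "subspace W"
    by (rule subspaceI) (auto simp: W_def scaleR_scale cip_scale cip_add, simp add: cip_def)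
  \<comment> \<open>Complex orthogonality to \<open>u j\<close> is real orthogonality to
    \<open>u j\<close> and \<open>\<i> *s u j\<close>. These are at most \<open>2 * card S\<close>
    vectors in real dimension \<open>2 * CARD('n)\<close>, so a nonzero orthogonal vector is
    left.\<close>
  define T where "T = u ` S \<union> (\<lambda>j. \<i> *s u j) ` S"
  have "card T \<le> card S + card S"
    unfolding T_def by (intro order_trans[OF card_Un_le] add_mono card_image_le) auto
  moreover have "card S < CARD('n)" using \<open>k0 \<notin> S\<close> by (intro psubset_card_mono) auto
  ultimately have "card T < DIM(complex^'n)" by simp
  then have "dim T < DIM(complex^'n)" using dim_le_card'[of T] by (simp add: T_def)
  then obtain w where w: "w \<noteq> 0" "\<And>y. y \<in> span T \<Longrightarrow> orthogonal w y"
    using orthogonal_to_subspace_exists by blast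
  have wW: "w \<in> W"
    unfolding W_def
  proof safe
    fix j assume "j \<in> S"
    then have "u j \<in> span T" "\<i> *s u j \<in> span T" by (auto intro!: span_base simp: T_def)
    then have "u j \<bullet> w = 0" "(\<i> *s u j) \<bullet> w = 0"
      using w(2) unfolding orthogonal_def inner_commute[of w] by blast+
    then show "cip (u j) w = 0" by (simp add: inner_eq_cip cip_scale complex_eq_iff)
  qed
  have XW: "X *v x \<in> W" if "x \<in> W" for x
    using that u X by (auto simp: W_def cip_cadj cip_scale hermitian_def)
  have sa: "(X *v x) \<bullet> y = x \<bullet> (X *v y)" for x y
    using X by (simp add: inner_eq_cip cip_cadj hermitian_def)
  obtain x m where x: "x \<in> W" "norm x = 1" "X *v x = m *\<^sub>R x"
    using selfadjoint_eigenvector[OF linear_matrix_vector_complex sa W XW wW w(1)] by blast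
  have "cip x x = 1" using x by (simp add: cip_self)
  moreover have "cip (u j) x = 0" "cip x (u j) = 0" if "j \<in> S" for j
    using x(1) that cip_commute[of x "u j"] by (auto simp: W_def)
  ultimately show ?case using u o x(3) \<open>k0 \<notin> S\<close>
    by (intro exI[of _ "u(k0 := x)"] exI[of _ "l(k0 := m)"]) (auto simp: scaleR_scale)
qed

theorem spectral_theorem:
  fixes X :: "complex^'n^'n"
  assumes X: "hermitian X"
  obtains U l where "unitary U" "X = U ** diagm (\<lambda>k. complex_of_real (l k)) ** cadj U"
proof -
  obtain u :: "'n \<Rightarrow> complex^'n" and l where "\<forall>k\<in>UNIV. X *v u k = complex_of_real (l k) *s u k"
    and "\<forall>j\<in>UNIV. \<forall>k\<in>UNIV. cip (u j) (u k) = of_bool (j = k)"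
    using orthonormal_eigenvectors[OF X, of UNIV] by blast
  then have u: "\<And>k. X *v u k = complex_of_real (l k) *s u k"
    and o: "\<And>j k. cip (u j) (u k) = of_bool (j = k)" by simp_all
  define U :: "complex^'n^'n" where "U = (\<chi> i k. u k $ i)"
  have 1: "cadj U ** U = mat 1"
    using o by (simp add: vec_eq_iff U_def cadj_def matrix_matrix_mult_def cip_def mat_def)
  then have 2: "U ** cadj U = mat 1" by (simp add: matrix_left_right_inverse)
  have "X ** U = U ** diagm (\<lambda>k. complex_of_real (l k))"
  proof -
    have "(X ** U) $ i $ k = (U ** diagm (\<lambda>k. complex_of_real (l k))) $ i $ k" for i k
    proof -
      have "(X ** U) $ i $ k = (X *v u k) $ i"
        by (simp add: matrix_matrix_mult_def matrix_vector_mult_def U_def)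
      also have "\<dots> = (U ** diagm (\<lambda>k. complex_of_real (l k))) $ i $ k"
        by (simp add: u matrix_matrix_mult_def U_def diagm_def if_distrib[where f="\<lambda>x. _ * x"] cong: if_cong)
      finally show ?thesis .
    qed
    then show ?thesis by (simp add: vec_eq_iff)
  qed
  then have "X = U ** diagm (\<lambda>k. complex_of_real (l k)) ** cadj U"
    by (metis 2 matrix_mul_assoc matrix_mul_rid)
  with 1 2 show thesis using that by (auto simp: unitary_def)
qed

section \<open>Real coordinates on Hermitian matrices\<close>

lemma matrix_mult_nth: "(A ** B) $ i $ k = (\<Sum>j\<in>UNIV. A $ i $ j * B $ j $ k)"
  by (simp add: matrix_matrix_mult_def)

lemma cadj_nth: "cadj A $ i $ j = cnj (A $ j $ i)"
  by (simp add: cadj_def)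

lemma Re_trace_mult: "Re (trace (A ** B)) = A \<bullet> cadj B" for A B :: "complex^'n^'n"
  by (simp add: trace_def matrix_matrix_mult_def cadj_def inner_vec_def inner_complex_def)

lemma linear_herm_of: "linear (herm_of :: real^'n^'n \<Rightarrow> complex^'n^'n)"
  by (rule linearI) (simp_all add: herm_of_def vec_eq_iff complex_eq_iff field_simps)

lemma hermitian_herm_of: "hermitian (herm_of a)"
  by (simp add: hermitian_def cadj_def herm_of_def vec_eq_iff complex_eq_iff add.commute diff_divide_distrib)

text \<open>The adjoint of \<open>herm_of\<close> for the real inner products, and its inverse on
  Hermitian matrices because \<open>herm_of\<close> is an isometry. On a general matrix it reads off
  the coordinates of the Hermitian part.\<close>

definition herm_adj :: "complex^'n^'n \<Rightarrow> real^'n^'n" where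
  "herm_adj Y = (\<chi> i j. (Re (Y $ i $ j) + Re (Y $ j $ i)) / 2 + (Im (Y $ i $ j) - Im (Y $ j $ i)) / 2)"

lemma linear_herm_adj: "linear (herm_adj :: complex^'n^'n \<Rightarrow> real^'n^'n)"
  by (rule linearI) (simp_all add: herm_adj_def vec_eq_iff field_simps)

lemma herm_adj_herm_of: "herm_adj (herm_of a) = a"
  by (simp add: herm_adj_def herm_of_def vec_eq_iff field_simps)

lemma herm_of_herm_adj:
  assumes "hermitian Y"
  shows "herm_of (herm_adj Y) = Y"
proof -
  have cnj: "cnj (Y $ j $ i) = Y $ i $ j" for i j
    using assms unfolding hermitian_def by (metis cadj_nth)
  have r: "Re (Y $ j $ i) = Re (Y $ i $ j)" "Im (Y $ j $ i) = - Im (Y $ i $ j)" for i j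
    using arg_cong[OF cnj[of j i], of Re] arg_cong[OF cnj[of j i], of Im] by simp_all
  have a: "herm_adj Y $ i $ j = Re (Y $ i $ j) + Im (Y $ i $ j)" for i j
    unfolding herm_adj_def using r[of j i] by simp
  have "herm_of (herm_adj Y) $ i $ j = Y $ i $ j" for i j
    unfolding herm_of_def using r[of j i] by (simp add: a complex_eq_iff)
  then show ?thesis by (simp add: vec_eq_iff)
qed

lemma inner_herm_of: "Y \<bullet> herm_of x = herm_adj Y \<bullet> x"
proof -
  have sw: "(\<Sum>i\<in>UNIV. \<Sum>j\<in>UNIV. f i j) = (\<Sum>i\<in>UNIV. \<Sum>j\<in>UNIV. f j i)" for f :: "'a \<Rightarrow> 'a \<Rightarrow> real"
    by (rule sum.swap)
  have "Y \<bullet> herm_of x = (\<Sum>i\<in>UNIV. \<Sum>j\<in>UNIV. (Re (Y$i$j) + Im (Y$i$j)) / 2 * x$i$j)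
      + (\<Sum>i\<in>UNIV. \<Sum>j\<in>UNIV. (Re (Y$i$j) - Im (Y$i$j)) / 2 * x$j$i)"
    unfolding sum.distrib[symmetric]
    by (simp add: inner_vec_def inner_complex_def herm_of_def field_simps)
  also have "(\<Sum>i\<in>UNIV. \<Sum>j\<in>UNIV. (Re (Y$i$j) - Im (Y$i$j)) / 2 * x$j$i)
      = (\<Sum>i\<in>UNIV. \<Sum>j\<in>UNIV. (Re (Y$j$i) - Im (Y$j$i)) / 2 * x$i$j)" by (rule sw)
  also have "(\<Sum>i\<in>UNIV. \<Sum>j\<in>UNIV. (Re (Y$i$j) + Im (Y$i$j)) / 2 * x$i$j) + \<dots> = herm_adj Y \<bullet> x"
    unfolding sum.distrib[symmetric]
    by (simp add: inner_vec_def herm_adj_def field_simps)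
  finally show ?thesis .
qed

lemma inner_herm_of_herm_of: "herm_of a \<bullet> herm_of b = a \<bullet> b"
  by (simp add: inner_herm_of herm_adj_herm_of)

lemma norm_herm_of: "norm (herm_of a) = norm a"
  by (simp add: norm_eq_sqrt_inner inner_herm_of_herm_of)

lemma trace_herm_of: "trace (herm_of x) = complex_of_real (x \<bullet> mat 1)"
  by (simp add: trace_def herm_of_def inner_vec_def mat_def complex_eq_iff if_distrib[where f="\<lambda>x. _ * x"] cong: if_cong)

section \<open>Diagonals in orthonormal bases and Peierls' inequality\<close>

lemma psd_iff: "psd A \<longleftrightarrow> hermitian A \<and> (\<forall>x. 0 \<le> x \<bullet> (A *v x))"
  by (simp add: psd_def cquad_eq_cip inner_eq_cip)

lemma posdef_iff: "posdef A \<longleftrightarrow> hermitian A \<and> (\<forall>x. x \<noteq> 0 \<longrightarrow> 0 < x \<bullet> (A *v x))"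
  by (simp add: posdef_def cquad_eq_cip inner_eq_cip)

abbreviation rdiag :: "('n \<Rightarrow> real) \<Rightarrow> complex^'n^'n" where
  "rdiag l \<equiv> diagm (\<lambda>k. complex_of_real (l k))"

definition diag_in :: "complex^'n^'n \<Rightarrow> complex^'n^'n \<Rightarrow> 'n \<Rightarrow> real" where
  "diag_in U X k = Re ((cadj U ** X ** U) $ k $ k)"

lemma diag_in_eq_inner: "diag_in U X k = column k U \<bullet> (X *v column k U)"
proof -
  have "(cadj U ** (X ** U)) $ k $ k = cip (column k U) (X *v column k U)"
    by (simp add: cip_def matrix_matrix_mult_def matrix_vector_mult_def cadj_def column_def)
  then show ?thesis by (simp add: diag_in_def inner_eq_cip matrix_mul_assoc)
qed

lemma linear_diag_in: "linear (\<lambda>X. diag_in U X k)"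
proof -
  have lin: "linear (\<lambda>X :: complex^'n^'n. X *v v)" for v
    by (rule linearI) (simp_all add: vec_eq_iff matrix_vector_mult_def scaleR_sum_right distrib_right sum.distrib)
  show ?thesis unfolding diag_in_eq_inner
    by (rule linearI) (simp_all add: linear_add[OF lin] linear_cmul[OF lin] inner_add_right)
qed

text \<open>For unitary \<open>U\<close> and \<open>V\<close> the weights form a doubly stochastic
  array, so diagonal entries are averages of eigenvalues.\<close>

lemma diag_in_spectral:
  assumes "X = V ** rdiag l ** cadj V"
  shows "diag_in U X k = (\<Sum>j\<in>UNIV. l j * (cmod ((cadj V ** U) $ j $ k))\<^sup>2)"
proof -
  define W where "W = cadj V ** U"
  have "cadj U ** X ** U = cadj W ** (rdiag l ** W)"
    unfolding assms W_def by (simp add: cadj_matrix_mul matrix_mul_assoc)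
  moreover have "(rdiag l ** W) $ j $ k = l j * W $ j $ k" for j
    by (simp add: matrix_matrix_mult_def diagm_def if_distrib[where f="\<lambda>x. x * _"] cong: if_cong)
  ultimately have "(cadj U ** X ** U) $ k $ k = (\<Sum>j\<in>UNIV. complex_of_real (l j) * (cnj (W $ j $ k) * W $ j $ k))"
    by (simp add: matrix_mult_nth[of "cadj W"] cadj_nth mult.left_commute)
  also have "\<dots> = complex_of_real (\<Sum>j\<in>UNIV. l j * (cmod (W $ j $ k))\<^sup>2)"
    by (simp add: mult.commute[of "cnj _"] complex_norm_square del: of_real_power)
  finally show ?thesis by (simp only: diag_in_def W_def Re_complex_of_real)
qed

lemma unitary_col_sum: "unitary W \<Longrightarrow> (\<Sum>j\<in>UNIV. (cmod (W $ j $ k))\<^sup>2) = 1"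
proof -
  assume "unitary W"
  then have "(cadj W ** W) $ k $ k = 1" by (simp add: unitary_def mat_def)
  then have "complex_of_real (\<Sum>j\<in>UNIV. (cmod (W $ j $ k))\<^sup>2) = 1"
    by (simp add: matrix_mult_nth cadj_def complex_norm_square mult.commute del: of_real_power)
  then show ?thesis by (simp only: of_real_eq_1_iff)
qed

lemma unitary_row_sum: "unitary W \<Longrightarrow> (\<Sum>k\<in>UNIV. (cmod (W $ j $ k))\<^sup>2) = 1"
proof -
  assume "unitary W"
  then have "(W ** cadj W) $ j $ j = 1" by (simp add: unitary_def mat_def)
  then have "complex_of_real (\<Sum>k\<in>UNIV. (cmod (W $ j $ k))\<^sup>2) = 1"
    by (simp add: matrix_mult_nth cadj_def complex_norm_square mult.commute del: of_real_power)
  then show ?thesis by (simp only: of_real_eq_1_iff)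
qed

lemma unitary_cadj_mult: "unitary V \<Longrightarrow> unitary U \<Longrightarrow> unitary (cadj V ** U)"
  unfolding unitary_def cadj_matrix_mul cadj_cadj
  by (metis matrix_mul_assoc matrix_mul_lid)

lemma diag_in_self:
  assumes "unitary V" "X = V ** rdiag l ** cadj V"
  shows "diag_in V X k = l k"
  using assms(1) by (simp add: diag_in_spectral[OF assms(2)] unitary_def mat_def
      if_distrib[where f=cmod] if_distrib[where f="\<lambda>x. x ^ 2"] if_distrib[where f="\<lambda>x. _ * x"] cong: if_cong)

lemma sum_diag_in: "unitary U \<Longrightarrow> (\<Sum>k\<in>UNIV. diag_in U X k) = Re (trace X)"
proof -
  assume U: "unitary U"
  have "(\<Sum>k\<in>UNIV. diag_in U X k) = Re (trace (cadj U ** (X ** U)))"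
    by (simp add: diag_in_def trace_def matrix_mul_assoc)
  also have "\<dots> = Re (trace (X ** U ** cadj U))" by (simp add: trace_mul_sym[of "cadj U"])
  also have "\<dots> = Re (trace X)" using U by (simp add: matrix_mul_assoc[symmetric] unitary_def)
  finally show ?thesis .
qed

lemma density_diag_in: "X \<in> density \<Longrightarrow> unitary U \<Longrightarrow> diag_in U X k \<in> {0..1}"
proof -
  assume X: "X \<in> density" and U: "unitary U"
  have pos: "0 \<le> diag_in U X j" for j
    using X by (simp add: density_def psd_iff diag_in_eq_inner)
  have "diag_in U X k \<le> (\<Sum>k\<in>UNIV. diag_in U X k)" using pos by (intro member_le_sum) auto
  also have "\<dots> = 1" using X U by (simp add: sum_diag_in density_def)
  finally show ?thesis using pos by simp
qed

text \<open>Column sums equal to 1 permit Jensen's inequality for each diagonal entry; row sums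
  equal to 1 then collapse the double sum.\<close>

lemma peierls:
  assumes X: "X \<in> density" and V: "unitary V" "X = V ** rdiag l ** cadj V" and U: "unitary U"
    and cv: "convex_on {0..1} \<psi>"
  shows "(\<Sum>k\<in>UNIV. \<psi> (diag_in U X k)) \<le> (\<Sum>j\<in>UNIV. \<psi> (l j))"
proof -
  define W where "W = cadj V ** U"
  have W: "unitary W" using V U by (simp add: W_def unitary_cadj_mult)
  have l: "l j \<in> {0..1}" for j using density_diag_in[OF X V(1), of j] diag_in_self[OF V] by simp
  have "\<psi> (diag_in U X k) \<le> (\<Sum>j\<in>UNIV. (cmod (W $ j $ k))\<^sup>2 * \<psi> (l j))" for k
    using convex_on_sum[OF _ _ cv, of UNIV "\<lambda>j. (cmod (W $ j $ k))\<^sup>2" l] l unitary_col_sum[OF W]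
    by (simp add: diag_in_spectral[OF V(2)] W_def mult.commute)
  then have "(\<Sum>k\<in>UNIV. \<psi> (diag_in U X k)) \<le> (\<Sum>k\<in>UNIV. \<Sum>j\<in>UNIV. (cmod (W $ j $ k))\<^sup>2 * \<psi> (l j))"
    by (rule sum_mono)
  also have "\<dots> = (\<Sum>j\<in>UNIV. \<Sum>k\<in>UNIV. (cmod (W $ j $ k))\<^sup>2 * \<psi> (l j))" by (rule sum.swap)
  also have "\<dots> = (\<Sum>j\<in>UNIV. \<psi> (l j))"
    by (simp add: sum_distrib_right[symmetric] unitary_row_sum[OF W])
  finally show ?thesis .
qed

text \<open>The value under \<open>SOME\<close> is independent of the decomposition: in an
  eigenbasis the diagonal consists of the eigenvalues, so Peierls' inequality applied both ways
  round equates the sums of two decompositions.\<close>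

lemma regularizer_eq:
  assumes X: "X \<in> density" and V: "unitary V" "X = V ** rdiag l ** cadj V"
    and cv: "convex_on {0..1} \<psi>"
  shows "regularizer \<psi> X = (\<Sum>k\<in>UNIV. \<psi> (l k))"
  unfolding regularizer_def
proof (rule some_equality)
  show "\<exists>U d. unitary U \<and> (\<forall>k. d k \<in> \<real>) \<and> X = U ** diagm d ** cadj U \<and> (\<Sum>k\<in>UNIV. \<psi> (l k)) = (\<Sum>k\<in>UNIV. \<psi> (Re (d k)))"
    using V by (intro exI[of _ V] exI[of _ "\<lambda>k. complex_of_real (l k)"]) simp
next
  fix s assume "\<exists>U d. unitary U \<and> (\<forall>k. d k \<in> \<real>) \<and> X = U ** diagm d ** cadj U \<and> s = (\<Sum>k\<in>UNIV. \<psi> (Re (d k)))"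
  then obtain U d where U: "unitary U" "\<And>k. d k \<in> \<real>" "X = U ** diagm d ** cadj U"
    and s: "s = (\<Sum>k\<in>UNIV. \<psi> (Re (d k)))" by blast
  have "d = (\<lambda>k. complex_of_real (Re (d k)))" using U(2) by (simp add: fun_eq_iff)
  then have U': "X = U ** rdiag (\<lambda>k. Re (d k)) ** cadj U" using U(3) by metis
  have "s \<le> (\<Sum>k\<in>UNIV. \<psi> (l k))"
    using peierls[OF X V U(1) cv] diag_in_self[OF U(1) U'] s by simp
  moreover have "(\<Sum>k\<in>UNIV. \<psi> (l k)) \<le> s"
    using peierls[OF X U(1) U' V(1) cv] diag_in_self[OF V] s by simp
  ultimately show "s = (\<Sum>k\<in>UNIV. \<psi> (l k))" by simp
qed

lemma density_spectral:
  assumes "X \<in> density"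
  obtains U l where "unitary U" "X = U ** rdiag l ** cadj U" "\<And>k. l k \<in> {0..1}" "\<And>k. diag_in U X k = l k"
proof -
  obtain U l where U: "unitary U" "X = U ** rdiag l ** cadj U"
    using spectral_theorem[of X] assms by (auto simp: density_def psd_def)
  then show thesis using that density_diag_in[OF assms U(1)] diag_in_self[OF U] by metis
qed

text \<open>With \<open>regularizer_attained\<close> this is a variational formula: the regularizer
  is a maximum over bases of sums that depend on \<open>X\<close> only through diagonals, which are
  linear in \<open>X\<close>.\<close>

lemma regularizer_ge:
  assumes "X \<in> density" "unitary U" "convex_on {0..1} \<psi>"
  shows "(\<Sum>k\<in>UNIV. \<psi> (diag_in U X k)) \<le> regularizer \<psi> X"
  using assms by (metis density_spectral peierls regularizer_eq)

lemma regularizer_attained: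
  assumes "X \<in> density" "convex_on {0..1} \<psi>"
  obtains U where "unitary U" "regularizer \<psi> X = (\<Sum>k\<in>UNIV. \<psi> (diag_in U X k))"
proof -
  obtain U l where U: "unitary U" "X = U ** rdiag l ** cadj U" "\<And>k. diag_in U X k = l k"
    using density_spectral[OF assms(1)] by metis
  then show thesis using that[of U] regularizer_eq[OF assms(1) U(1,2) assms(2)] by simp
qed

text \<open>Ties the kernel \<open>c * x\<^sup>2\<close> to \<open>c\<close> times the squared
  Frobenius norm, which turns strong convexity of the kernel into strong convexity on
  matrices.\<close>

lemma spectral_norm2:
  assumes "unitary U" "X = U ** rdiag l ** cadj U"
  shows "(norm X)\<^sup>2 = (\<Sum>k\<in>UNIV. (l k)\<^sup>2)"
proof -
  have "cadj (rdiag l) = rdiag l" by (simp add: cadj_def diagm_def vec_eq_iff)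
  then have herm: "cadj X = X" by (simp add: assms(2) cadj_matrix_mul matrix_mul_assoc)
  have "X ** X = U ** rdiag l ** (cadj U ** U) ** rdiag l ** cadj U"
    by (simp add: assms(2) matrix_mul_assoc)
  also have "\<dots> = U ** (rdiag l ** rdiag l) ** cadj U"
    using assms(1) by (simp add: unitary_def matrix_mul_assoc)
  also have "rdiag l ** rdiag l = rdiag (\<lambda>k. (l k)\<^sup>2)"
    by (simp add: matrix_matrix_mult_def diagm_def vec_eq_iff power2_eq_square if_distrib[where f="\<lambda>x. x * _"] cong: if_cong)
  finally have XX: "X ** X = U ** rdiag (\<lambda>k. (l k)\<^sup>2) ** cadj U" .
  have "(norm X)\<^sup>2 = Re (trace (X ** X))" by (simp add: Re_trace_mult herm power2_norm_eq_inner)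
  also have "\<dots> = (\<Sum>k\<in>UNIV. diag_in U (X ** X) k)" using sum_diag_in[OF assms(1)] by metis
  also have "\<dots> = (\<Sum>k\<in>UNIV. (l k)\<^sup>2)" using diag_in_self[OF assms(1) XX] by simp
  finally show ?thesis .
qed

section \<open>The quantum mirror map\<close>

text \<open>Contractions towards 1/2 map the closed interval into the open one and commute with
  convex combinations, so the inequality reaches the endpoints by continuity.\<close>

lemma convex_on_unit_intervalI:
  fixes f :: "real \<Rightarrow> real"
  assumes cont: "continuous_on {0..1} f" and cv: "convex_on {0<..<1} f"
  shows "convex_on {0..1} f"
proof (rule convex_onI)
  fix t x y :: real assume t: "0 < t" "t < 1" and xy: "x \<in> {0..1}" "y \<in> {0..1}"
  define d where "d n = 1 / real (n + 2)" for n
  define s where "s n x = (1 - d n) * x + d n / 2" for n x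
  have s_in: "s n x \<in> {0<..<1}" if "x \<in> {0..1}" for n x
  proof -
    have d: "0 < d n" "d n < 1" by (auto simp: d_def)
    then have "0 \<le> (1 - d n) * x" "(1 - d n) * x \<le> 1 - d n" using that by (auto intro: mult_left_le)
    then have "0 < s n x" "s n x < 1" using d unfolding s_def by linarith+
    then show ?thesis by simp
  qed
  have d_lim: "d \<longlonglongrightarrow> 0"
    using LIMSEQ_ignore_initial_segment[OF lim_1_over_n, of 2] by (simp add: d_def[abs_def])
  have s_lim: "(\<lambda>n. s n x) \<longlonglongrightarrow> x" for x
    unfolding s_def by (rule tendsto_eq_intros d_lim refl | simp)+
  have f_lim: "(\<lambda>n. f (s n x)) \<longlonglongrightarrow> f x" if "x \<in> {0..1}" for x
    by (rule continuous_on_tendsto_compose[OF cont s_lim that])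
      (use s_in[OF that] in \<open>auto intro!: always_eventually less_imp_le\<close>)
  have z: "(1 - t) * x + t * y \<in> {0..1}"
    using convexD_alt[OF convex_closed_interval[of 0 1] _ _ _ _, of x y t] xy t by simp
  have "s n ((1 - t) * x + t * y) = (1 - t) * s n x + t * s n y" for n
    by (simp add: s_def field_simps)
  then have "f (s n ((1 - t) * x + t * y)) \<le> (1 - t) * f (s n x) + t * f (s n y)" for n
    using convex_onD[OF cv, of t "s n x" "s n y"] s_in xy t by simp
  moreover have "(\<lambda>n. (1 - t) * f (s n x) + t * f (s n y)) \<longlonglongrightarrow> (1 - t) * f x + t * f y"
    using xy by (intro tendsto_intros f_lim)
  ultimately have "f ((1 - t) * x + t * y) \<le> (1 - t) * f x + t * f y"
    using LIMSEQ_le[OF f_lim[OF z]] by blast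
  then show "f ((1 - t) *\<^sub>R x + t *\<^sub>R y) \<le> (1 - t) * f x + t * f y" by simp
qed simp

lemma admissible_kernel_strongly_convex:
  assumes "admissible_kernel \<theta>"
  obtains c where "0 < c" "convex_on {0..1} (\<lambda>x. \<theta> x - c * x\<^sup>2)"
proof -
  obtain \<theta>' \<theta>'' c where cont: "continuous_on {0..1} \<theta>"
    and d: "\<And>x. x \<in> {0<..1} \<Longrightarrow> (\<theta> has_real_derivative \<theta>' x) (at x within {0<..1})"
      "\<And>x. x \<in> {0<..1} \<Longrightarrow> (\<theta>' has_real_derivative \<theta>'' x) (at x within {0<..1})"
    and c: "0 < c" "\<And>x. x \<in> {0<..1} \<Longrightarrow> c \<le> \<theta>'' x"
    using assms unfolding admissible_kernel_def by blast
  have at: "(f has_real_derivative D) (at x)" if "(f has_real_derivative D) (at x within {0<..1})" "x \<in> {0<..<1}" for f D and x :: real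
  proof -
    have "(f has_real_derivative D) (at x within {0<..<1})" by (rule DERIV_subset[OF that(1)]) auto
    then show ?thesis using that(2) at_within_open[of x "{0<..<1}"] by simp
  qed
  \<comment> \<open>Half of \<open>c\<close>, since the second derivative of
    \<open>c / 2 * x\<^sup>2\<close> is \<open>c\<close>. The derivative test runs on the open
    interval, where the relative derivatives are ordinary ones.\<close>
  have "convex_on {0<..<1} (\<lambda>x. \<theta> x - c / 2 * x\<^sup>2)"
  proof (rule f''_ge0_imp_convex[where f'="\<lambda>x. \<theta>' x - c * x" and f''="\<lambda>x. \<theta>'' x - c"])
    fix x :: real assume x: "x \<in> {0<..<1}"
    show "((\<lambda>x. \<theta> x - c / 2 * x\<^sup>2) has_real_derivative \<theta>' x - c * x) (at x)"
      by (rule derivative_eq_intros at[OF d(1)] refl | use x in simp)+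
    show "((\<lambda>x. \<theta>' x - c * x) has_real_derivative \<theta>'' x - c) (at x)"
      by (rule derivative_eq_intros at[OF d(2)] refl | use x in simp)+
    show "0 \<le> \<theta>'' x - c" using c(2)[of x] x by simp
  qed (rule convex_real_interval)
  then have "convex_on {0..1} (\<lambda>x. \<theta> x - c / 2 * x\<^sup>2)"
    by (intro convex_on_unit_intervalI continuous_intros cont)
  then show thesis using that[of "c / 2"] c(1) by simp
qed

text \<open>Move from the maximiser a fraction \<open>t\<close> towards \<open>x\<close>. Convexity
  of \<open>g\<close> and the exact expansion of the squared norm leave a surplus
  \<open>t * (1 - t) * Q\<close>; dividing by \<open>t\<close> and letting \<open>t\<close> tend to
  0 gives the full constant \<open>c\<close>.\<close>

lemma strongly_convex_argmax:
  fixes K :: "'a::real_inner set"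
  assumes K: "compact K" "K \<noteq> {}" and g: "convex_on K g" and c: "0 \<le> c"
    and h: "\<And>x. x \<in> K \<Longrightarrow> h x = g x + c * (norm x)\<^sup>2" and cont: "continuous_on K h"
  shows "\<exists>x0\<in>K. \<forall>x\<in>K. b \<bullet> x - h x + c * (norm (x - x0))\<^sup>2 \<le> b \<bullet> x0 - h x0"
proof -
  have convK: "convex K" using g by (rule convex_on_imp_convex)
  obtain x0 where x0: "x0 \<in> K" and max: "\<And>x. x \<in> K \<Longrightarrow> b \<bullet> x - h x \<le> b \<bullet> x0 - h x0"
    using continuous_attains_sup[OF K, of "\<lambda>x. b \<bullet> x - h x"] continuous_on_diff[OF continuous_on_inner[OF continuous_on_const continuous_on_id] cont]
    by blast
  have "b \<bullet> x - h x + c * (norm (x - x0))\<^sup>2 \<le> b \<bullet> x0 - h x0" if x: "x \<in> K" for x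
  proof -
    define D where "D = (b \<bullet> x0 - h x0) - (b \<bullet> x - h x)"
    define Q where "Q = c * (norm (x - x0))\<^sup>2"
    have le: "(1 - t) * Q \<le> D" if t: "0 < t" "t < 1" for t
    proof -
      define y where "y = (1 - t) *\<^sub>R x0 + t *\<^sub>R x"
      have yK: "y \<in> K" unfolding y_def using convexD_alt[OF convK x0 x, of t] t by simp
      have gy: "g y \<le> (1 - t) * g x0 + t * g x" unfolding y_def using convex_onD[OF g, of t x0 x] t x0 x by simp
      have ny: "(norm y)\<^sup>2 = (1 - t) * (norm x0)\<^sup>2 + t * (norm x)\<^sup>2 - t * (1 - t) * (norm (x - x0))\<^sup>2"
        unfolding y_def power2_norm_eq_inner
        by (simp add: inner_add_left inner_add_right inner_diff_left inner_diff_right inner_commute algebra_simps power2_eq_square)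
      have "b \<bullet> y = (1 - t) * (b \<bullet> x0) + t * (b \<bullet> x)" by (simp add: y_def inner_add_right)
      moreover have "h y \<le> (1 - t) * h x0 + t * h x - t * (1 - t) * Q"
        using gy unfolding h[OF yK] h[OF x0] h[OF x] ny Q_def by (simp add: algebra_simps)
      ultimately have "t * ((1 - t) * Q) \<le> t * D"
        using max[OF yK] unfolding D_def by (simp add: algebra_simps)
      then show ?thesis using t by simp
    qed
    have "Q \<le> D"
    proof (rule field_le_mult_one_interval)
      fix s :: real assume "0 < s" "s < 1"
      then show "s * Q \<le> D" using le[of "1 - s"] by simp
    qed
    then show ?thesis by (simp add: D_def Q_def)
  qed
  then show ?thesis using x0 by blast
qed

section \<open>Density matrices in real coordinates\<close>

definition density_coords :: "(real^'n^'n) set" where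
  "density_coords = {x. herm_of x \<in> density}"

lemma herm_adj_density: "X \<in> density \<Longrightarrow> herm_adj X \<in> density_coords \<and> herm_of (herm_adj X) = X"
  by (auto simp: density_coords_def density_def psd_def herm_of_herm_adj)

lemma density_coords_iff:
  "x \<in> density_coords \<longleftrightarrow> (\<forall>v. 0 \<le> v \<bullet> (herm_of x *v v)) \<and> x \<bullet> mat 1 = 1"
  by (simp add: density_coords_def density_def psd_iff hermitian_herm_of trace_herm_of)

lemma linear_herm_of_mv: "linear (\<lambda>x. herm_of x *v v)"
  by (rule linearI)
    (simp_all add: linear_add[OF linear_herm_of] linear_cmul[OF linear_herm_of] vec_eq_iff
      matrix_vector_mult_def scaleR_sum_right distrib_right sum.distrib)

lemma herm_of_mv_bound:
  obtains B where "0 < B" "\<And>x v. norm (herm_of x *v v) \<le> B * norm x * norm (v :: complex^'n)"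
proof -
  have "bilinear (\<lambda>x v. herm_of x *v (v :: complex^'n))"
    unfolding bilinear_def using linear_herm_of_mv linear_matrix_vector_complex by blast
  then show thesis using that bilinear_bounded_pos by blast
qed

lemma convex_density_coords: "convex density_coords"
proof -
  have "density_coords = (\<Inter>v. {x. 0 \<le> v \<bullet> (herm_of x *v v)}) \<inter> {x::real^'a^'a. x \<bullet> mat 1 = 1}"
    by (auto simp: density_coords_iff)
  moreover have "convex {x::real^'a^'a. 0 \<le> v \<bullet> (herm_of x *v v)}" for v
    by (intro convexI) (simp add: linear_add[OF linear_herm_of_mv] linear_cmul[OF linear_herm_of_mv] inner_add_right)
  moreover have "convex {x::real^'a^'a. x \<bullet> mat 1 = 1}"
    using convex_hyperplane[of "mat 1 :: real^'a^'a" 1] by (simp add: inner_commute)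
  ultimately show ?thesis by (metis (no_types, lifting) convex_Int convex_INT)
qed

lemma norm_density_coords: "x \<in> density_coords \<Longrightarrow> norm x \<le> sqrt CARD('n)" for x :: "real^'n^'n"
proof -
  assume "x \<in> density_coords"
  then have X: "herm_of x \<in> density" by (simp add: density_coords_def)
  obtain U l where U: "unitary U" "herm_of x = U ** rdiag l ** cadj U" "\<And>k. l k \<in> {0..1}"
    using density_spectral[OF X] by metis
  have "(norm x)\<^sup>2 = (\<Sum>k\<in>UNIV. (l k)\<^sup>2)" using spectral_norm2[OF U(1,2)] by (simp add: norm_herm_of)
  also have "\<dots> \<le> (\<Sum>k\<in>(UNIV::'n set). 1)" using U(3) by (intro sum_mono) (simp add: power_le_one)
  finally show ?thesis by (simp add: real_le_rsqrt)
qed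

lemma compact_density_coords: "compact density_coords"
proof -
  have "density_coords = (\<Inter>v. {x. 0 \<le> v \<bullet> (herm_of x *v v)}) \<inter> {x::real^'a^'a. x \<bullet> mat 1 = 1}"
    by (auto simp: density_coords_iff)
  moreover have "closed {x::real^'a^'a. 0 \<le> v \<bullet> (herm_of x *v v)}" for v
    by (intro closed_Collect_le continuous_intros linear_continuous_on linear_conv_bounded_linear[THEN iffD1] linear_herm_of_mv)
  moreover have "closed {x::real^'a^'a. x \<bullet> mat 1 = 1}"
    by (intro closed_Collect_eq continuous_intros)
  ultimately have "closed (density_coords :: (real^'a^'a) set)"
    by (metis (no_types, lifting) closed_Int closed_INT)
  then show ?thesis using norm_density_coords by (auto simp: compact_eq_bounded_closed intro: boundedI)
qed

text \<open>A basis that is optimal for the mixture gives lower bounds at both endpoints, and in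
  that fixed basis the diagonals mix linearly.\<close>

lemma convex_regularizer:
  assumes cv: "convex_on {0..1} \<psi>"
  shows "convex_on density_coords (\<lambda>x. regularizer \<psi> (herm_of x))"
proof (rule convex_onI[OF _ convex_density_coords])
  fix t :: real and x y :: "real^'a^'a"
  assume t: "0 < t" "t < 1" and xy: "x \<in> density_coords" "y \<in> density_coords"
  define z where "z = (1 - t) *\<^sub>R x + t *\<^sub>R y"
  have zd: "herm_of z \<in> density"
    using convexD_alt[OF convex_density_coords xy, of t] t by (simp add: density_coords_def z_def)
  have xd: "herm_of x \<in> density" and yd: "herm_of y \<in> density" using xy by (auto simp: density_coords_def)
  obtain U where U: "unitary U" and e: "regularizer \<psi> (herm_of z) = (\<Sum>k\<in>UNIV. \<psi> (diag_in U (herm_of z) k))"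
    using regularizer_attained[OF zd cv] by blast
  have "diag_in U (herm_of z) k = (1 - t) * diag_in U (herm_of x) k + t * diag_in U (herm_of y) k" for k
    by (simp add: z_def linear_add[OF linear_herm_of] linear_cmul[OF linear_herm_of]
        linear_add[OF linear_diag_in] linear_cmul[OF linear_diag_in])
  then have "\<psi> (diag_in U (herm_of z) k) \<le> (1 - t) * \<psi> (diag_in U (herm_of x) k) + t * \<psi> (diag_in U (herm_of y) k)" for k
    using convex_onD[OF cv, of t "diag_in U (herm_of x) k" "diag_in U (herm_of y) k"] t
      density_diag_in[OF xd U, of k] density_diag_in[OF yd U, of k] by simp
  then have "regularizer \<psi> (herm_of z) \<le> (\<Sum>k\<in>UNIV. (1 - t) * \<psi> (diag_in U (herm_of x) k) + t * \<psi> (diag_in U (herm_of y) k))"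
    unfolding e by (rule sum_mono)
  also have "\<dots> = (1 - t) * (\<Sum>k\<in>UNIV. \<psi> (diag_in U (herm_of x) k)) + t * (\<Sum>k\<in>UNIV. \<psi> (diag_in U (herm_of y) k))"
    by (simp add: sum.distrib sum_distrib_left)
  also have "\<dots> \<le> (1 - t) * regularizer \<psi> (herm_of x) + t * regularizer \<psi> (herm_of y)"
    using t by (intro add_mono mult_left_mono regularizer_ge xd yd U cv) auto
  finally show "regularizer \<psi> (herm_of ((1 - t) *\<^sub>R x + t *\<^sub>R y)) \<le> (1 - t) * regularizer \<psi> (herm_of x) + t * regularizer \<psi> (herm_of y)"
    by (simp add: z_def)
qed

lemma regularizer_split:
  assumes x: "x \<in> density_coords" and cv: "convex_on {0..1} (\<lambda>x. \<theta> x - c * x\<^sup>2)" and c: "0 \<le> c"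
  shows "regularizer \<theta> (herm_of x) = regularizer (\<lambda>x. \<theta> x - c * x\<^sup>2) (herm_of x) + c * (norm x)\<^sup>2"
    and "convex_on {0..1} \<theta>"
proof -
  have "convex_on {0..1} (\<lambda>x::real. x\<^sup>2)"
    by (rule convex_on_subset[OF convex_power2]) simp_all
  then have "convex_on {0..1} (\<lambda>x. (\<theta> x - c * x\<^sup>2) + c * x\<^sup>2)"
    by (intro convex_on_add cv convex_on_cmul c)
  then show cv\<theta>: "convex_on {0..1} \<theta>" by simp
  have X: "herm_of x \<in> density" using x by (simp add: density_coords_def)
  obtain U l where U: "unitary U" "herm_of x = U ** rdiag l ** cadj U"
    using density_spectral[OF X] by metis
  show "regularizer \<theta> (herm_of x) = regularizer (\<lambda>x. \<theta> x - c * x\<^sup>2) (herm_of x) + c * (norm x)\<^sup>2"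
    using spectral_norm2[OF U] unfolding regularizer_eq[OF X U cv] regularizer_eq[OF X U cv\<theta>] norm_herm_of
    by (simp add: sum_subtractf sum_distrib_left)
qed

lemma norm_unitary_column: "unitary U \<Longrightarrow> norm (column k U) = 1"
proof -
  assume "unitary U"
  then have "(norm (column k U))\<^sup>2 = 1"
    using unitary_col_sum[of U k] by (simp add: norm_vec_def L2_set_def column_def sum_nonneg)
  then show "norm (column k U) = 1" by (metis abs_norm_cancel abs_1 abs_neg_one power2_eq_1_iff)
qed

text \<open>Continuity has to hold up to rank-deficient matrices. A basis optimal at one matrix is a
  competitor at the other, so uniform continuity of the kernel bounds the difference from one side;
  exchanging roles bounds it from the other.\<close>

lemma continuous_regularizer:
  assumes cv: "convex_on {0..1} \<theta>" and cont: "continuous_on {0..1} \<theta>"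
  shows "continuous_on density_coords (\<lambda>x :: real^'n^'n. regularizer \<theta> (herm_of x))"
proof -
  obtain B where B: "0 < B" "\<And>x v. norm (herm_of x *v v) \<le> B * norm x * norm (v :: complex^'n)"
    using herm_of_mv_bound by blast
  have diff: "\<bar>diag_in U (herm_of x) k - diag_in U (herm_of y) k\<bar> \<le> B * norm (x - y)"
    if U: "unitary U" for U x k and y :: "real^'n^'n"
  proof -
    have "diag_in U (herm_of x) k - diag_in U (herm_of y) k = diag_in U (herm_of (x - y)) k"
      by (simp add: linear_diff[OF linear_herm_of] linear_diff[OF linear_diag_in])
    also have "\<bar>\<dots>\<bar> \<le> norm (column k U) * norm (herm_of (x - y) *v column k U)"
      unfolding diag_in_eq_inner by (rule Cauchy_Schwarz_ineq2)
    also have "\<dots> \<le> B * norm (x - y)" using B(2)[of "x - y" "column k U"] by (simp add: norm_unitary_column[OF U])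
    finally show ?thesis .
  qed
  have uc: "uniformly_continuous_on {0..1} \<theta>" by (intro compact_uniformly_continuous cont) simp
  show ?thesis
    unfolding continuous_on_iff
  proof (intro ballI allI impI)
    fix x :: "real^'n^'n" and e :: real assume x: "x \<in> density_coords" and e: "0 < e"
    \<comment> \<open>The errors of the diagonal entries then sum to \<open>e / 2\<close>, leaving
      room for the strict inequality.\<close>
    define e' where "e' = e / (2 * CARD('n))"
    have e': "0 < e'" using e by (simp add: e'_def)
    then obtain d where d: "0 < d" "\<And>a b. a \<in> {0..1} \<Longrightarrow> b \<in> {0..1} \<Longrightarrow> \<bar>a - b\<bar> < d \<Longrightarrow> \<bar>\<theta> a - \<theta> b\<bar> < e'"
      using uc unfolding uniformly_continuous_on_def dist_real_def by metis
    have one: "regularizer \<theta> (herm_of y) \<le> regularizer \<theta> (herm_of z) + e / 2"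
      if y: "y \<in> density_coords" and z: "z \<in> density_coords" and yz: "norm (y - z) < d / B" for y z :: "real^'n^'n"
    proof -
      have yd: "herm_of y \<in> density" and zd: "herm_of z \<in> density" using y z by (auto simp: density_coords_def)
      obtain U where U: "unitary U" and eq: "regularizer \<theta> (herm_of y) = (\<Sum>k\<in>UNIV. \<theta> (diag_in U (herm_of y) k))"
        using regularizer_attained[OF yd cv] by blast
      have "B * norm (y - z) < d" using yz B(1) by (simp add: field_simps)
      then have "\<theta> (diag_in U (herm_of y) k) \<le> \<theta> (diag_in U (herm_of z) k) + e'" for k
        using d(2)[OF density_diag_in[OF yd U, of k] density_diag_in[OF zd U, of k]] diff[OF U, of y k z] by simp
      then have "regularizer \<theta> (herm_of y) \<le> (\<Sum>k\<in>UNIV. \<theta> (diag_in U (herm_of z) k) + e')"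
        unfolding eq by (rule sum_mono)
      also have "\<dots> = (\<Sum>k\<in>UNIV. \<theta> (diag_in U (herm_of z) k)) + e / 2" by (simp add: sum.distrib e'_def)
      also have "\<dots> \<le> regularizer \<theta> (herm_of z) + e / 2" using regularizer_ge[OF zd U cv] by simp
      finally show ?thesis .
    qed
    show "\<exists>d>0. \<forall>x'\<in>density_coords. dist x' x < d \<longrightarrow> dist (regularizer \<theta> (herm_of x')) (regularizer \<theta> (herm_of x)) < e"
    proof (intro exI[of _ "d / B"] conjI ballI impI)
      fix y :: "real^'n^'n" assume y: "y \<in> density_coords" and yx: "dist y x < d / B"
      have "norm (y - x) < d / B" "norm (x - y) < d / B" using yx by (simp_all add: dist_norm norm_minus_commute)
      then have "\<bar>regularizer \<theta> (herm_of y) - regularizer \<theta> (herm_of x)\<bar> \<le> e / 2"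
        using one[OF y x] one[OF x y] by linarith
      then show "dist (regularizer \<theta> (herm_of y)) (regularizer \<theta> (herm_of x)) < e" using e by (simp add: dist_real_def)
    qed (use d B in simp)
  qed
qed

text \<open>The quadratic growth makes the maximiser unique, as \<open>THE\<close> demands; the
  trace pairing with Hermitian matrices sees \<open>Y\<close> through \<open>herm_adj Y\<close>
  alone.\<close>

lemma mirror_eq:
  assumes c: "0 < c" and x0: "x0 \<in> density_coords"
    and max: "\<And>x. x \<in> density_coords \<Longrightarrow> herm_adj Y \<bullet> x - regularizer \<theta> (herm_of x) + c * (norm (x - x0))\<^sup>2
      \<le> herm_adj Y \<bullet> x0 - regularizer \<theta> (herm_of (x0))"
  shows "mirror \<theta> Y = herm_of (x0)"
proof -
  have tr: "Re (trace (Y ** herm_of x)) = herm_adj Y \<bullet> x" for x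
    using hermitian_herm_of[of x] by (simp add: Re_trace_mult hermitian_def inner_herm_of)
  show ?thesis
    unfolding mirror_def
  proof (rule the_equality)
    show "herm_of x0 \<in> density \<and> (\<forall>X'\<in>density. Re (trace (Y ** X')) - regularizer \<theta> X'
        \<le> Re (trace (Y ** herm_of x0)) - regularizer \<theta> (herm_of x0))"
    proof (intro conjI ballI)
      show "herm_of x0 \<in> density" using x0 by (simp add: density_coords_def)
      fix X' :: "complex^'a^'a" assume "X' \<in> density"
      then have x: "herm_adj X' \<in> density_coords" "herm_of (herm_adj X') = X'" using herm_adj_density by auto
      have "0 \<le> c * (norm (herm_adj X' - x0))\<^sup>2" using c by simp
      then show "Re (trace (Y ** X')) - regularizer \<theta> X' \<le> Re (trace (Y ** herm_of x0)) - regularizer \<theta> (herm_of x0)"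
        using max[OF x(1)] tr[of "herm_adj X'"] tr[of x0] x(2) by simp
    qed
  next
    fix X assume X: "X \<in> density \<and> (\<forall>X'\<in>density. Re (trace (Y ** X')) - regularizer \<theta> X' \<le> Re (trace (Y ** X)) - regularizer \<theta> X)"
    then have x: "herm_adj X \<in> density_coords" "herm_of (herm_adj X) = X" using herm_adj_density by auto
    have "Re (trace (Y ** herm_of x0)) - regularizer \<theta> (herm_of x0) \<le> Re (trace (Y ** X)) - regularizer \<theta> X"
      using X x0 by (simp add: density_coords_def)
    then have "c * (norm (herm_adj X - x0))\<^sup>2 \<le> 0"
      using max[OF x(1)] tr[of "herm_adj X"] tr[of x0] x(2) by simp
    then have "herm_adj X = x0" using c by (simp add: mult_le_0_iff)
    then show "X = herm_of x0" using x(2) by simp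
  qed
qed

text \<open>The quadratic form has a positive minimum \<open>m\<close> on the unit sphere, and a
  perturbation of norm at most \<open>m / B\<close> alters it there by at most
  \<open>m\<close>.\<close>

lemma posdef_interior:
  assumes pd: "posdef (herm_of xs)" and xs: "xs \<in> density_coords"
  obtains \<epsilon> where "0 < \<epsilon>" "\<And>v. v \<bullet> mat 1 = 0 \<Longrightarrow> norm v \<le> \<epsilon> \<Longrightarrow> xs + v \<in> density_coords"
proof -
  obtain B where B: "0 < B" "\<And>x v. norm (herm_of x *v v) \<le> B * norm x * norm (v :: complex^'a)"
    using herm_of_mv_bound by blast
  have cont: "continuous_on (sphere 0 1) (\<lambda>w. w \<bullet> (herm_of xs *v w))"
    by (intro continuous_intros linear_continuous_on linear_conv_bounded_linear[THEN iffD1] linear_matrix_vector_complex)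
  obtain w0 :: "complex^'a" where w0: "w0 \<in> sphere 0 1"
    and min: "\<And>w. w \<in> sphere 0 1 \<Longrightarrow> w0 \<bullet> (herm_of xs *v w0) \<le> w \<bullet> (herm_of xs *v w)"
    using continuous_attains_inf[OF compact_sphere _ cont] by auto
  define m where "m = w0 \<bullet> (herm_of xs *v w0)"
  have "w0 \<noteq> 0" using w0 by auto
  then have m: "0 < m" using pd unfolding posdef_iff m_def by blast
  have quad: "m * (norm w)\<^sup>2 \<le> w \<bullet> (herm_of xs *v w)" for w
  proof (cases "w = 0")
    case False
    have "m \<le> ((1 / norm w) *\<^sub>R w) \<bullet> (herm_of xs *v ((1 / norm w) *\<^sub>R w))"
      unfolding m_def using False by (intro min) simp
    also have "\<dots> = (w \<bullet> (herm_of xs *v w)) / (norm w)\<^sup>2"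
      by (simp add: linear_cmul[OF linear_matrix_vector_complex] power2_eq_square)
    finally show ?thesis using False by (simp add: le_divide_eq)
  qed simp
  show thesis
  proof (rule that[of "m / B"])
    show "0 < m / B" using m B by simp
    fix v :: "real^'a^'a" assume v: "v \<bullet> mat 1 = 0" "norm v \<le> m / B"
    have "0 \<le> w \<bullet> (herm_of (xs + v) *v w)" for w
    proof -
      have "\<bar>w \<bullet> (herm_of v *v w)\<bar> \<le> norm w * (B * norm v * norm w)"
        using Cauchy_Schwarz_ineq2[of w "herm_of v *v w"] mult_left_mono[OF B(2)[of v w], of "norm w"] by simp
      also have "\<dots> = (B * norm v) * (norm w)\<^sup>2" by (simp add: power2_eq_square)
      also have "\<dots> \<le> m * (norm w)\<^sup>2" using v(2) B(1) by (intro mult_right_mono) (auto simp: field_simps)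
      finally show ?thesis using quad[of w] by (simp add: linear_add[OF linear_herm_of_mv] inner_add_right)
    qed
    then show "xs + v \<in> density_coords" using xs v(1) by (simp add: density_coords_iff inner_add_left)
  qed
qed

section \<open>Payoff gradients as linear maps\<close>

lemma linear_kron1: "linear (\<lambda>A :: complex^'n^'n. kron A (B :: complex^'m^'m))"
  by (rule linearI) (simp_all add: kron_def vec_eq_iff distrib_right)

lemma linear_kron2: "linear (\<lambda>B :: complex^'m^'m. kron (A :: complex^'n^'n) B)"
  by (rule linearI) (simp_all add: kron_def vec_eq_iff distrib_left)

lemma linear_trace_mult: "linear (\<lambda>X :: complex^'n^'n. trace (A ** X))"
  by (rule linearI)
    (simp_all add: trace_def matrix_matrix_mult_def distrib_left sum.distrib scaleR_sum_right)

lemma linear_payoff1: "linear (\<lambda>x. payoff P U (herm_of x) B)"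
proof -
  have "linear (\<lambda>x. trace (P w ** kron (herm_of x) B))" for w
    using linear_compose[OF linear_compose[OF linear_herm_of linear_kron1] linear_trace_mult]
    by (simp add: o_def)
  note lin = this
  show ?thesis
    by (rule linearI)
      (simp_all add: payoff_def linear_add[OF lin] linear_cmul[OF lin] distrib_left sum.distrib sum_distrib_left)
qed

lemma linear_payoff2: "linear (\<lambda>x. payoff P U A (herm_of x))"
proof -
  have "linear (\<lambda>x. trace (P w ** kron A (herm_of x)))" for w
    using linear_compose[OF linear_compose[OF linear_herm_of linear_kron2] linear_trace_mult]
    by (simp add: o_def)
  note lin = this
  show ?thesis
    by (rule linearI)
      (simp_all add: payoff_def linear_add[OF lin] linear_cmul[OF lin] distrib_left sum.distrib sum_distrib_left)
qed

definition riesz :: "('a::euclidean_space \<Rightarrow> real) \<Rightarrow> 'a" where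
  "riesz f = (\<Sum>b\<in>Basis. f b *\<^sub>R b)"

lemma inner_riesz:
  assumes "linear f"
  shows "x \<bullet> riesz f = f x"
proof -
  have "f x = f (\<Sum>b\<in>Basis. (x \<bullet> b) *\<^sub>R b)" by (simp add: euclidean_representation)
  also have "\<dots> = (\<Sum>b\<in>Basis. (x \<bullet> b) * f b)" by (simp add: linear_sum[OF assms] linear_cmul[OF assms])
  finally show ?thesis by (simp add: riesz_def inner_sum_right mult.commute)
qed

lemma linear_riesz:
  fixes f :: "'c::real_vector \<Rightarrow> 'a::euclidean_space \<Rightarrow> real"
  assumes "\<And>b. linear (\<lambda>y. f y b)"
  shows "linear (\<lambda>y. riesz (f y))"
  by (rule linearI)
    (simp_all add: riesz_def linear_add[OF assms] linear_cmul[OF assms] scaleR_left_distrib sum.distrib scaleR_sum_right)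

text \<open>Evaluates the definite descriptions in \<open>grad1\<close> and \<open>grad2\<close>: on
  Hermitian matrices the trace form is the inner product of coordinates, hence
  nondegenerate.\<close>

lemma the_hermitian_gradient:
  assumes "\<And>x. f (herm_of x) = x \<bullet> m"
  shows "(THE V. hermitian V \<and> (\<forall>A. hermitian A \<longrightarrow> f A = Re (trace (A ** V)))) = herm_of m"
proof (rule the_equality)
  have tr: "Re (trace (herm_of x ** V)) = x \<bullet> herm_adj V" if "hermitian V" for x V
    using that inner_herm_of[of V x] by (simp add: Re_trace_mult hermitian_def inner_commute)
  show "hermitian (herm_of m) \<and> (\<forall>A. hermitian A \<longrightarrow> f A = Re (trace (A ** herm_of m)))"
  proof (intro conjI allI impI hermitian_herm_of)
    fix A :: "complex^'a^'a" assume "hermitian A"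
    then show "f A = Re (trace (A ** herm_of m))"
      using tr[OF hermitian_herm_of, of "herm_adj A" m] assms[of "herm_adj A"]
      by (simp add: herm_of_herm_adj herm_adj_herm_of)
  qed
  fix V assume V: "hermitian V \<and> (\<forall>A. hermitian A \<longrightarrow> f A = Re (trace (A ** V)))"
  have "x \<bullet> herm_adj V = x \<bullet> m" for x
    using V tr[of V x] assms[of x] hermitian_herm_of[of x] by simp
  then have "herm_adj V = m" by (metis vector_eq_ldot)
  then show "V = herm_of m" using V herm_of_herm_adj by metis
qed

section \<open>The quantum game as an instance of the abstract one\<close>

lemma density_mirror_map:
  assumes \<theta>: "admissible_kernel \<theta>" and X: "X \<in> density" "posdef X"
  obtains q c \<epsilon> H where "mirror_map density_coords (\<lambda>x. regularizer \<theta> (herm_of x)) q c (mat 1) (herm_adj X) \<epsilon> H"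
    "\<And>Y. mirror \<theta> Y = herm_of (q (herm_adj Y))"
proof -
  let ?K = "density_coords :: (real^'a^'a) set" and ?h = "\<lambda>x::real^'a^'a. regularizer \<theta> (herm_of x)"
  have xs: "herm_adj X \<in> ?K" "herm_of (herm_adj X) = X" using herm_adj_density X by auto
  obtain c where c: "0 < c" and cv: "convex_on {0..1} (\<lambda>x. \<theta> x - c * x\<^sup>2)"
    using admissible_kernel_strongly_convex[OF \<theta>] by blast
  have cont: "continuous_on ?K ?h"
    using \<theta> c by (intro continuous_regularizer regularizer_split(2)[OF xs(1) cv]) (auto simp: admissible_kernel_def)
  have "\<exists>x0\<in>?K. \<forall>x\<in>?K. b \<bullet> x - ?h x + c * (norm (x - x0))\<^sup>2 \<le> b \<bullet> x0 - ?h x0" for b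
    using xs(1) c by (intro strongly_convex_argmax[OF compact_density_coords _ convex_regularizer[OF cv]] regularizer_split(1) cv cont) auto
  then obtain q where q: "\<And>b. q b \<in> ?K"
    "\<And>b x. x \<in> ?K \<Longrightarrow> b \<bullet> x - ?h x + c * (norm (x - q b))\<^sup>2 \<le> b \<bullet> q b - ?h (q b)" by metis
  obtain \<epsilon> where eps: "0 < \<epsilon>" "\<And>v. v \<bullet> mat 1 = 0 \<Longrightarrow> norm v \<le> \<epsilon> \<Longrightarrow> herm_adj X + v \<in> ?K"
    using posdef_interior[of "herm_adj X"] xs X by metis
  obtain H where H: "\<And>x. x \<in> ?K \<Longrightarrow> ?h x \<le> H"
    using continuous_attains_sup[OF compact_density_coords _ cont] xs(1) by blast
  have "mirror_map ?K ?h q c (mat 1) (herm_adj X) \<epsilon> H"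
  proof
    show "(mat 1 :: real^'a^'a) \<noteq> 0" by (simp add: vec_eq_iff mat_def)
  qed (use c q eps H in \<open>auto simp: density_coords_iff\<close>)
  moreover have "mirror \<theta> Y = herm_of (q (herm_adj Y))" for Y
    by (rule mirror_eq[OF c q(1)[of "herm_adj Y"] q(2)])
  ultimately show thesis using that by blast
qed

text \<open>From the relatively interior point \<open>xs\<close> a short step away from
  \<open>x\<close> stays in \<open>K\<close>; maximality against that point is the reverse
  inequality.\<close>

lemma (in mirror_map) linear_max_constant:
  assumes max: "\<And>x. x \<in> K \<Longrightarrow> x \<bullet> m \<le> xs \<bullet> m" and x: "x \<in> K"
  shows "x \<bullet> m = xs \<bullet> m"
proof (cases "x = xs")
  case False
  define s where "s = \<epsilon> / norm (x - xs)"
  have s: "0 < s" using False eps_pos by (simp add: s_def)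
  have "xs + (- s) *\<^sub>R (x - xs) \<in> K"
    using e_const[OF x xs_in] False eps_pos by (intro interior) (auto simp: s_def inner_diff_left)
  from max[OF this] have "0 \<le> s * ((x - xs) \<bullet> m)"
    unfolding inner_add_left inner_scaleR_left by simp
  then have "xs \<bullet> m \<le> x \<bullet> m" using s by (simp add: zero_le_mult_iff inner_diff_left)
  with max[OF x] show ?thesis by simp
qed simp

theorem theorem3:
  fixes P :: "'w::finite \<Rightarrow> complex^('n::finite \<times> 'm::finite)^('n \<times> 'm)"
    and U1 U2 :: "'w \<Rightarrow> real"
    and \<theta>1 \<theta>2 :: "real \<Rightarrow> real"
    and X1s :: "complex^'n^'n" and X2s :: "complex^'m^'m"
  assumes "povm P"
    and "admissible_kernel \<theta>1" and "admissible_kernel \<theta>2"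
    and zero_sum: "\<forall>X1\<in>density. \<forall>X2\<in>density. payoff P U1 X1 X2 = - payoff P U2 X1 X2"
    and "nash_eq P U1 U2 X1s X2s"
    and "posdef X1s" and "posdef X2s"
  shows "AE a in lborel. \<forall>Y :: real \<Rightarrow> (complex^'n^'n) \<times> (complex^'m^'m).
           ftql_solution P U1 U2 \<theta>1 \<theta>2 Y \<and> Y 0 = (herm_of (fst a), herm_of (snd a)) \<longrightarrow>
           (\<exists>t :: nat \<Rightarrow> real. strict_mono t \<and> filterlim t at_top sequentially \<and>
              ((\<lambda>n. (mirror \<theta>1 (fst (Y (t n))), mirror \<theta>2 (snd (Y (t n)))))
                 \<longlongrightarrow> (mirror \<theta>1 (fst (Y 0)), mirror \<theta>2 (snd (Y 0)))) sequentially)"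
proof -
  have X1s: "X1s \<in> density" and X2s: "X2s \<in> density" using assms(5) by (auto simp: nash_eq_def)
  define x1s x2s where "x1s = herm_adj X1s" and "x2s = herm_adj X2s"
  have xs: "x1s \<in> density_coords" "herm_of x1s = X1s" "x2s \<in> density_coords" "herm_of x2s = X2s"
    using herm_adj_density[OF X1s] herm_adj_density[OF X2s] by (auto simp: x1s_def x2s_def)
  obtain q1 c1 \<epsilon>1 H1 where
    m1: "mirror_map density_coords (\<lambda>x. regularizer \<theta>1 (herm_of x)) q1 c1 (mat 1) x1s \<epsilon>1 H1"
    and q1: "\<And>Y. mirror \<theta>1 Y = herm_of (q1 (herm_adj Y))"
    using density_mirror_map[OF assms(2) X1s assms(6)] unfolding x1s_def by blast
  obtain q2 c2 \<epsilon>2 H2 where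
    m2: "mirror_map density_coords (\<lambda>x. regularizer \<theta>2 (herm_of x)) q2 c2 (mat 1) x2s \<epsilon>2 H2"
    and q2: "\<And>Y. mirror \<theta>2 Y = herm_of (q2 (herm_adj Y))"
    using density_mirror_map[OF assms(3) X2s assms(7)] unfolding x2s_def by blast
  \<comment> \<open>Each map comes from its own player's payoff and is linear on the whole space,
    whereas the zero-sum identity is available on density matrices.\<close>
  define M :: "real^'m^'m \<Rightarrow> real^'n^'n" where "M y = riesz (\<lambda>x. payoff P U1 (herm_of x) (herm_of y))" for y
  define N :: "real^'n^'n \<Rightarrow> real^'m^'m" where "N x = riesz (\<lambda>y. payoff P U2 (herm_of x) (herm_of y))" for x
  have M_eq: "x \<bullet> M y = payoff P U1 (herm_of x) (herm_of y)" for x y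
    unfolding M_def by (rule inner_riesz[OF linear_payoff1])
  have N_eq: "y \<bullet> N x = payoff P U2 (herm_of x) (herm_of y)" for x y
    unfolding N_def by (rule inner_riesz[OF linear_payoff2])
  have zs: "x \<bullet> M y + y \<bullet> N x = 0" if "x \<in> density_coords" "y \<in> density_coords" for x y
    using zero_sum that by (simp add: M_eq N_eq density_coords_def)
  have n1: "x \<bullet> M x2s = x1s \<bullet> M x2s" if "x \<in> density_coords" for x
    using assms(5) xs that by (intro mirror_map.linear_max_constant[OF m1]) (auto simp: M_eq nash_eq_def density_coords_def)
  have n2: "y \<bullet> N x1s = x2s \<bullet> N x1s" if "y \<in> density_coords" for y
    using assms(5) xs that by (intro mirror_map.linear_max_constant[OF m2]) (auto simp: N_eq nash_eq_def density_coords_def)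
  interpret zero_sum_game density_coords "\<lambda>x. regularizer \<theta>1 (herm_of x)" q1 c1 "mat 1" x1s \<epsilon>1 H1
    density_coords "\<lambda>x. regularizer \<theta>2 (herm_of x)" q2 c2 "mat 1" x2s \<epsilon>2 H2 M N
  proof (intro zero_sum_game.intro zero_sum_game_axioms.intro m1 m2)
    show "bounded_linear M" "bounded_linear N"
      unfolding M_def N_def linear_conv_bounded_linear[symmetric]
      by (rule linear_riesz, rule linear_payoff2, rule linear_riesz, rule linear_payoff1)
    \<comment> \<open>By the zero-sum identity the left side is minus the payoffs of
      \<open>y\<close> against \<open>x1s\<close> and of \<open>x\<close> against
      \<open>x2s\<close>; indifference replaces \<open>y\<close> and \<open>x\<close> by the
      equilibrium strategies, where the identity applies once more.\<close>
    show "x1s \<bullet> M y + x2s \<bullet> N x = 0" if "x \<in> density_coords" "y \<in> density_coords" for x y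
      using zs[OF xs(1) that(2)] zs[OF that(1) xs(3)] zs[OF xs(1) xs(3)] n1[OF that(1)] n2[OF that(2)] by linarith
  qed (auto intro: compact_imp_bounded compact_density_coords zs)
  \<comment> \<open>By multilinearity a player's gradient does not involve the player's own
    strategy, hence the arbitrary \<open>X\<close>.\<close>
  have g1: "grad1 P U1 X (herm_of y) = herm_of (M y)" for X y
    unfolding grad1_def by (rule the_hermitian_gradient) (simp add: M_eq)
  have g2: "grad2 P U2 (herm_of x) X = herm_of (N x)" for X x
    unfolding grad2_def by (rule the_hermitian_gradient) (simp add: N_eq)
  show ?thesis
    using recurrence
  proof (rule AE_mp, intro AE_I2 impI allI, elim conjE)
    fix a :: "(real^'n^'n) \<times> (real^'m^'m)" and Y :: "real \<Rightarrow> (complex^'n^'n) \<times> (complex^'m^'m)"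
    assume rec: "\<forall>z. z 0 = a \<and> (\<forall>t\<ge>0. (z has_vector_derivative (M (q2 (snd (z t))), N (q1 (fst (z t))))) (at t within {0..})) \<longrightarrow>
       (\<exists>t::nat \<Rightarrow> real. strict_mono t \<and> filterlim t at_top sequentially \<and>
        ((\<lambda>n. q1 (fst (z (t n)))) \<longlonglongrightarrow> q1 (fst a)) \<and> ((\<lambda>n. q2 (snd (z (t n)))) \<longlonglongrightarrow> q2 (snd a)))"
      and sol: "ftql_solution P U1 U2 \<theta>1 \<theta>2 Y" and Y0: "Y 0 = (herm_of (fst a), herm_of (snd a))"
    \<comment> \<open>The mirror maps depend on \<open>Y t\<close> only through these coordinates,
      and \<open>herm_adj\<close> undoes \<open>herm_of\<close> in the velocity.\<close>
    define z where "z t = (herm_adj (fst (Y t)), herm_adj (snd (Y t)))" for t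
    have "z 0 = a" by (simp add: z_def Y0 herm_adj_herm_of)
    moreover have "(z has_vector_derivative (M (q2 (snd (z t))), N (q1 (fst (z t))))) (at t within {0..})" if "t \<ge> 0" for t
    proof -
      have d: "(Y has_vector_derivative (herm_of (M (q2 (snd (z t)))), herm_of (N (q1 (fst (z t)))))) (at t within {0..})"
        using sol that unfolding ftql_solution_def by (simp add: q1 q2 g1 g2 z_def)
      have "((\<lambda>t. herm_adj (fst (Y t))) has_vector_derivative M (q2 (snd (z t)))) (at t within {0..})"
        "((\<lambda>t. herm_adj (snd (Y t))) has_vector_derivative N (q1 (fst (z t)))) (at t within {0..})"
        using bounded_linear.has_vector_derivative[OF linear_herm_adj[unfolded linear_conv_bounded_linear] bounded_linear.has_vector_derivative[OF bounded_linear_fst d]]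
          bounded_linear.has_vector_derivative[OF linear_herm_adj[unfolded linear_conv_bounded_linear] bounded_linear.has_vector_derivative[OF bounded_linear_snd d]]
        by (simp_all add: herm_adj_herm_of)
      then show ?thesis unfolding z_def[abs_def] by (simp add: has_vector_derivative_Pair z_def)
    qed
    ultimately obtain t :: "nat \<Rightarrow> real" where t: "strict_mono t" "filterlim t at_top sequentially"
      "(\<lambda>n. q1 (fst (z (t n)))) \<longlonglongrightarrow> q1 (fst a)" "(\<lambda>n. q2 (snd (z (t n)))) \<longlonglongrightarrow> q2 (snd a)"
      using rec by blast
    have "(\<lambda>n. mirror \<theta>1 (fst (Y (t n)))) \<longlonglongrightarrow> mirror \<theta>1 (fst (Y 0))"
      using isCont_tendsto_compose[OF linear_continuous_at[OF linear_herm_of[unfolded linear_conv_bounded_linear]] t(3)]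
      by (simp add: q1 z_def Y0 herm_adj_herm_of)
    moreover have "(\<lambda>n. mirror \<theta>2 (snd (Y (t n)))) \<longlonglongrightarrow> mirror \<theta>2 (snd (Y 0))"
      using isCont_tendsto_compose[OF linear_continuous_at[OF linear_herm_of[unfolded linear_conv_bounded_linear]] t(4)]
      by (simp add: q2 z_def Y0 herm_adj_herm_of)
    ultimately show "\<exists>t :: nat \<Rightarrow> real. strict_mono t \<and> filterlim t at_top sequentially \<and>
        ((\<lambda>n. (mirror \<theta>1 (fst (Y (t n))), mirror \<theta>2 (snd (Y (t n)))))
          \<longlongrightarrow> (mirror \<theta>1 (fst (Y 0)), mirror \<theta>2 (snd (Y 0)))) sequentially"
      using t(1,2) by (intro exI[of _ t] conjI tendsto_Pair)
  qed
qed

end
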